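(* Let $d\ge1$, $\lambda,\mu>0$, and let $g:\mathbb{R}^d\to[0,1]$ be a non-increasing radial function with $0<\|g\|=\int_{\mathbb{R}^d}g(x)\,dx<\infty$. Let $D$ be the degree of the origin vertex in the random intersection graph $\mathcal{G}_{\mathcal{V}}$. Then $D$ is stochastically dominated by $\sum_{i=1}^{N}X_i$, where $\{X_i\}_{i\geq1}$ are i.i.d. Poisson random variables with mean $\lambda\|g\|$ and $N$ is a Poisson random variable with mean $\mu\|g\|$, independent of $\{X_i\}_{i\geq1}$.
   Context: A function $g:\mathbb{R}^d\to[0,1]$ is a non-increasing radial function if $g(x)=g(y)$ whenever $|x|=|y|$ and $g(x)\leq g(y)$ whenever $|x|\geq|y|$, where $|\cdot|$ is the Euclidean norm. Model. Let $\mathcal{V}$ (vertices) and $\mathcal{U}$ (groups) be the point sets of two independent homogeneous Poisson processes on $\mathbb{R}^d$ with intensities $\lambda$ and $\mu$, respectively, and add a point at the origin to $\mathcal{V}$ (Palm version). Given $\mathcal{V}$ and $\mathcal{U}$, each pair $(v,u)$ with $v\in\mathcal{V}$, $u\in\mathcal{U}$ is connected independently with probability $g(v-u)$; this gives a bipartite graph $\mathcal{G}_{\mathrm{bi}}$ with vertex set $\mathcal{V}\cup\mathcal{U}$. The random intersection graph $\mathcal{G}_{\mathcal{V}}$ has vertex set $\mathcal{V}$, and two distinct points $v_1,v_2\in\mathcal{V}$ are connected by an edge if and only if there exists $u\in\mathcal{U}$ such that both $v_1$ and $v_2$ are connected to $u$ in $\mathcal{G}_{\mathrm{bi}}$. The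 degree of the origin is the number of vertices $v\in\mathcal{V}\setminus\{0\}$ that are connected to $0$ in $\mathcal{G}_{\mathcal{V}}$. A random variable $A$ is stochastically dominated by $B$ if $\mathbb{P}(A>t)\leq\mathbb{P}(B>t)$ for all $t\in\mathbb{R}$. *)

theory Defs
  imports "HOL-Probability.Probability"
begin

definition nonincreasing_radial :: "('a::euclidean_space \<Rightarrow> real) \<Rightarrow> bool" where
  "nonincreasing_radial g \<longleftrightarrow>
     (\<forall>x y. norm x = norm y \<longrightarrow> g x = g y) \<and>
     (\<forall>x y. norm x \<ge> norm y \<longrightarrow> g x \<le> g y)"

text \<open>The library's \<open>poisson_pmf\<close> is only specified for positive rates; rate \<open>0\<close> is needed for the
  counts of a Poisson process in null sets.\<close>

definition poisson_law :: "real \<Rightarrow> nat pmf" where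
  "poisson_law c = (if c = 0 then return_pmf 0 else poisson_pmf c)"

text \<open>A homogeneous Poisson process of positive intensity has almost surely infinitely many points,
  so it is given by a measurable enumeration \<open>X\<close> of its points without repetitions; the point set
  itself is \<open>points X \<omega>\<close>. Since \<open>card\<close> is \<open>0\<close> on infinite sets, finiteness of the counts
  is required separately.\<close>

definition points :: "(nat \<Rightarrow> 'w \<Rightarrow> 'a) \<Rightarrow> 'w \<Rightarrow> 'a set" where
  "points X \<omega> = range (\<lambda>i. X i \<omega>)"

definition poisson_process ::
    "'w measure \<Rightarrow> real \<Rightarrow> (nat \<Rightarrow> 'w \<Rightarrow> 'a::euclidean_space) \<Rightarrow> bool" where
  "poisson_process M c X \<longleftrightarrow>
     (\<forall>i. X i \<in> borel_measurable M) \<and>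
     (AE \<omega> in M. inj (\<lambda>i. X i \<omega>)) \<and>
     (\<forall>A. A \<in> sets borel \<and> emeasure lborel A < \<infinity> \<longrightarrow>
        (AE \<omega> in M. finite (points X \<omega> \<inter> A)) \<and>
        (\<lambda>\<omega>. card (points X \<omega> \<inter> A)) \<in> measurable M (count_space UNIV) \<and>
        distr M (count_space UNIV) (\<lambda>\<omega>. card (points X \<omega> \<inter> A))
          = measure_pmf (poisson_law (c * measure lborel A))) \<and>
     (\<forall>n (A :: nat \<Rightarrow> 'a set).
        (\<forall>i<n. A i \<in> sets borel \<and> emeasure lborel (A i) < \<infinity>) \<and> disjoint_family_on A {..<n} \<longrightarrow>
        prob_space.indep_vars M (\<lambda>_. count_space UNIV) (\<lambda>i \<omega>. card (points X \<omega> \<inter> A i)) {..<n})"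

text \<open>Palm version: the origin is added, as vertex number \<open>0\<close>.\<close>

definition palm :: "(nat \<Rightarrow> 'w \<Rightarrow> 'a::zero) \<Rightarrow> nat \<Rightarrow> 'w \<Rightarrow> 'a" where
  "palm X i \<omega> = (case i of 0 \<Rightarrow> 0 | Suc k \<Rightarrow> X k \<omega>)"

text \<open>The random bipartite graph, with \<open>E \<omega>\<close> its set of edges (vertex, group). The sigma-algebra
  \<open>positions\<close> is generated by the two point processes. The last assumption says that given the two
  processes, the pairs (vertex, group) are independently edges, with probabilities \<open>g (v - u)\<close>
  (independence of events in the sense of the product formula for all finite subfamilies).\<close>

definition positions ::
    "'w measure \<Rightarrow> (nat \<Rightarrow> 'w \<Rightarrow> 'a::euclidean_space) \<Rightarrow> (nat \<Rightarrow> 'w \<Rightarrow> 'a) \<Rightarrow> 'w measure" where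
  "positions M X Y =
     vimage_algebra (space M) (\<lambda>\<omega>. (\<lambda>i. X i \<omega>, \<lambda>j. Y j \<omega>))
       ((\<Pi>\<^sub>M i\<in>UNIV. borel) \<Otimes>\<^sub>M (\<Pi>\<^sub>M j\<in>UNIV. borel))"

locale random_bipartite_graph = prob_space M
  for M :: "'w measure" +
  fixes lam mu :: real
    and g :: "'a::euclidean_space \<Rightarrow> real"
    and X Y :: "nat \<Rightarrow> 'w \<Rightarrow> 'a"
    and E :: "'w \<Rightarrow> ('a \<times> 'a) set"
  assumes vertex_process: "poisson_process M lam X"
    and group_process: "poisson_process M mu Y"
    and processes_indep:
      "indep_var (\<Pi>\<^sub>M i\<in>UNIV. borel) (\<lambda>\<omega> i. X i \<omega>) (\<Pi>\<^sub>M j\<in>UNIV. borel) (\<lambda>\<omega> j. Y j \<omega>)"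
    and edges_bipartite: "\<And>\<omega>. \<omega> \<in> space M \<Longrightarrow> E \<omega> \<subseteq> points (palm X) \<omega> \<times> points Y \<omega>"
    and edges_measurable: "\<And>i j. {\<omega> \<in> space M. (palm X i \<omega>, Y j \<omega>) \<in> E \<omega>} \<in> sets M"
    and edges_cond_indep:
      "\<And>S :: (nat \<times> nat) set. finite S \<Longrightarrow>
         AE \<omega> in M.
           real_cond_exp M (positions M X Y)
             (indicator {\<omega> \<in> space M. \<forall>(i, j)\<in>S. (palm X i \<omega>, Y j \<omega>) \<in> E \<omega>}) \<omega>
           = (\<Prod>(i, j)\<in>S. g (palm X i \<omega> - Y j \<omega>))"

definition intersection_adj :: "'a set \<Rightarrow> 'a set \<Rightarrow> ('a \<times> 'a) set \<Rightarrow> 'a \<Rightarrow> 'a \<Rightarrow> bool" where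
  "intersection_adj V U F v1 v2 \<longleftrightarrow>
     v1 \<in> V \<and> v2 \<in> V \<and> v1 \<noteq> v2 \<and> (\<exists>u\<in>U. (v1, u) \<in> F \<and> (v2, u) \<in> F)"

definition ecard :: "'a set \<Rightarrow> enat" where
  "ecard S = (if finite S then enat (card S) else \<infinity>)"

definition origin_degree ::
    "(nat \<Rightarrow> 'w \<Rightarrow> 'a::zero) \<Rightarrow> (nat \<Rightarrow> 'w \<Rightarrow> 'a) \<Rightarrow> ('w \<Rightarrow> ('a \<times> 'a) set) \<Rightarrow> 'w \<Rightarrow> enat" where
  "origin_degree X Y E \<omega> =
     ecard {v \<in> points (palm X) \<omega> - {0}.
              intersection_adj (points (palm X) \<omega>) (points Y \<omega>) (E \<omega>) 0 v}"

text \<open>Measurability is part of the definition because \<open>measure\<close> is \<open>0\<close> on nonmeasurable sets.\<close>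

definition stoch_dominated ::
    "'w measure \<Rightarrow> ('w \<Rightarrow> ereal) \<Rightarrow> 'v measure \<Rightarrow> ('v \<Rightarrow> ereal) \<Rightarrow> bool" where
  "stoch_dominated M A M' B \<longleftrightarrow>
     A \<in> borel_measurable M \<and> B \<in> borel_measurable M' \<and>
     (\<forall>t::real. measure M {\<omega> \<in> space M. A \<omega> > ereal t} \<le> measure M' {\<omega> \<in> space M'. B \<omega> > ereal t})"

end

theory Submission
  imports Defs
begin

text \<open>Suppose that the origin is joined to exactly \<open>n\<close> groups, at positions \<open>u\<^sub>1, ..., u\<^sub>n\<close>. Given
  these, every other vertex at \<open>x\<close> shares a group with the origin with probability
  \<open>1 - (1 - g (x - u\<^sub>1)) ... (1 - g (x - u\<^sub>n))\<close>, independently of the other vertices. Thinning the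
  Poisson process of vertices shows that the degree of the origin is Poisson distributed, and by the
  union bound its mean is at most \<open>n * lam\<close> times the integral of \<open>g\<close>. Poisson laws increase
  stochastically with their mean, so the degree is dominated by a Poisson variable with the larger
  mean, which is a sum of \<open>n\<close> independent copies of \<open>Z 1\<close>. Finally \<open>n\<close> is itself random.
  Thinning the process of groups shows that it is Poisson distributed with mean \<open>mu\<close> times the
  integral of \<open>g\<close>. So the mixture over \<open>n\<close> is the asserted compound Poisson law.

  Both thinnings are carried out with generating functions. If \<open>K\<close> counts the points of a Poisson
  process that are retained with probability \<open>f\<close>, then the mean of \<open>s ^ K\<close> is the mean of the
  product of \<open>1 - (1 - s) * f\<close> over the points. The latter is the Laplace functional, evaluated in
  \<open>laplace_functional\<close> from step functions and Campbell's formula. The law of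
  \<open>K\<close> is then read off from its generating function by \<open>count_law\<close>.

  The conditional independence of the edges speaks of finitely many edges at a time. Accordingly the
  degree is first truncated to finitely many vertices and groups. Its generating function is then a
  polynomial in edge indicators that is affine in each of them, and in the mean the indicators may be
  replaced by their conditional probabilities (\<open>expectation_nbh_conn\<close>). Letting the number of
  vertices tend to infinity gives the Laplace functional (\<open>expectation_conn_limit\<close>). The resulting
  lower bound on the distribution function (\<open>count_conn_cdf_ge\<close>) is uniform in the number of
  groups, so it survives the second limit.\<close>

section \<open>Poisson weights\<close>

text \<open>The weights are given by the formula so that mean \<open>0\<close> is included: \<open>pois 0\<close> is the point mass
  at \<open>0\<close>. This mean occurs for null sets and when the origin has no groups.\<close>

definition pois :: "real \<Rightarrow> nat \<Rightarrow> real" where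
  "pois c n = c ^ n / fact n * exp (- c)"

definition pois_cdf :: "real \<Rightarrow> nat \<Rightarrow> real" where
  "pois_cdf c m = (\<Sum>n\<le>m. pois c n)"

lemma pois_nonneg: "0 \<le> c \<Longrightarrow> 0 \<le> pois c n"
  by (simp add: pois_def)

lemma pois_pgf: "(\<lambda>n. pois c n * s ^ n) sums exp (- ((1 - s) * c))"
proof -
  have "(\<lambda>n. exp (- c) * ((c * s) ^ n /\<^sub>R fact n)) sums (exp (- c) * exp (c * s))"
    by (intro sums_mult exp_converges)
  also have "exp (- c) * exp (c * s) = exp (- ((1 - s) * c))"
    by (simp add: exp_add [symmetric] algebra_simps)
  finally show ?thesis
    by (simp add: pois_def power_mult_distrib field_simps)
qed

lemma pmf_poisson_law: "0 \<le> c \<Longrightarrow> pmf (poisson_law c) n = pois c n"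
  by (simp add: poisson_law_def pois_def pmf_return split: split_indicator)

lemma pois_sums_1: "pois c sums 1"
  using pois_pgf[of c 1] by simp

lemma pois_cdf_nonneg: "0 \<le> c \<Longrightarrow> 0 \<le> pois_cdf c m"
  by (simp add: pois_cdf_def sum_nonneg pois_nonneg)

lemma pois_le_1: "0 \<le> c \<Longrightarrow> pois c n \<le> 1"
  using sum_le_suminf[OF sums_summable[OF pois_sums_1], of "{n}" c] sums_unique[OF pois_sums_1, of c]
  by (simp add: pois_nonneg)

text \<open>The derivative of each weight in the mean is the difference of two consecutive weights, so the
  derivative of the distribution function telescopes. Its negative sign is the stochastic
  monotonicity of Poisson laws in their mean.\<close>

lemma DERIV_pois_cdf: "((\<lambda>c. pois_cdf c m) has_real_derivative - pois c m) (at c)"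
proof (induction m)
  case 0
  show ?case
    unfolding pois_cdf_def pois_def by (auto intro!: derivative_eq_intros)
next
  case (Suc m)
  have "((\<lambda>c. pois c (Suc m)) has_real_derivative pois c m - pois c (Suc m)) (at c)"
  proof -
    have "((\<lambda>c. c ^ Suc m / fact (Suc m) * exp (- c)) has_real_derivative
        (real (Suc m) * c ^ m) / fact (Suc m) * exp (- c) + c ^ Suc m / fact (Suc m) * (exp (- c) * (- 1))) (at c)"
      by (rule derivative_eq_intros refl | simp)+
    moreover have "(real (Suc m) * c ^ m) / fact (Suc m) = c ^ m / fact m"
      by (simp add: divide_simps del: of_nat_Suc)
    ultimately show ?thesis
      by (simp add: pois_def)
  qed
  from DERIV_add[OF Suc this] show ?case
    by (simp add: pois_cdf_def)
qed

lemma pois_cdf_antimono: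
  assumes "0 \<le> a" "a \<le> b"
  shows "pois_cdf b m \<le> pois_cdf a m"
proof (rule DERIV_nonpos_imp_nonincreasing[OF assms(2), of "\<lambda>c. pois_cdf c m"])
  fix x assume "a \<le> x" "x \<le> b"
  then show "\<exists>y. ((\<lambda>c. pois_cdf c m) has_real_derivative y) (at x) \<and> y \<le> 0"
    using DERIV_pois_cdf[of m x] pois_nonneg[of x m] assms by (intro exI[of _ "- pois x m"]) auto
qed

section \<open>Generating functions and counts of events\<close>

text \<open>The lowest coefficient of the difference of the two series that is still undecided is the limit,
  as \<open>s\<close> decreases to \<open>0\<close>, of the difference divided by a power of \<open>s\<close>. Equality for
  \<open>s\<close> in \<open>[0, 1)\<close> therefore suffices. This is the range in which \<open>1 - s\<close> is a probability.\<close>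

lemma pgf_coeffs_unique:
  fixes a b :: "nat \<Rightarrow> real"
  assumes a: "\<And>s. 0 \<le> s \<Longrightarrow> s < 1 \<Longrightarrow> (\<lambda>n. a n * s ^ n) sums f s"
    and b: "\<And>s. 0 \<le> s \<Longrightarrow> s < 1 \<Longrightarrow> (\<lambda>n. b n * s ^ n) sums f s"
  shows "a n = b n"
proof (induction n rule: less_induct)
  case (less n)
  define d where "d k = a (k + n) - b (k + n)" for k
  have d: "(\<lambda>k. d k * s ^ k) sums 0" if "0 < s" "s < 1" for s
  proof -
    have "(\<lambda>k. (a k - b k) * s ^ k) sums 0"
      using sums_diff[OF a[of s] b[of s]] that by (simp add: algebra_simps)
    then have "(\<lambda>k. (a (k + n) - b (k + n)) * s ^ (k + n)) sums 0"
      by (subst sums_zero_iff_shift) (use less in auto)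
    from sums_mult[OF this, of "1 / s ^ n"] that show ?thesis
      by (simp add: d_def power_add)
  qed
  have "(\<lambda>k. d k * x ^ k) sums (\<Sum>k. d k * x ^ k)" if "norm x < 1 / 2" for x :: real
  proof -
    have "summable (\<lambda>k. d k * (1 / 2) ^ k)"
      using d[of "1 / 2"] by (simp add: sums_iff)
    from powser_inside[OF this, of x] that show ?thesis
      by (simp add: summable_sums)
  qed
  then have "((\<lambda>x. \<Sum>k. d k * x ^ k) \<longlongrightarrow> d 0) (at 0)"
    by (rule powser_limit_0[rotated, where s="1 / 2"]) simp_all
  then have "((\<lambda>x. \<Sum>k. d k * x ^ k) \<longlongrightarrow> d 0) (at_right 0)"
    using filterlim_mono[OF _ order_refl at_le[of "{0<..}" UNIV 0]] by blast
  moreover have "eventually (\<lambda>x. (\<Sum>k. d k * x ^ k) = 0) (at_right (0::real))"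
    unfolding eventually_at_right_field by (rule exI[of _ 1]) (use d in \<open>simp add: sums_iff\<close>)
  then have "((\<lambda>x. \<Sum>k. d k * x ^ k) \<longlongrightarrow> 0) (at_right (0::real))"
    by (rule tendsto_eventually)
  ultimately have "d 0 = 0"
    by (rule tendsto_unique[rotated]) simp
  then show ?case
    by (simp add: d_def)
qed

text \<open>For \<open>0 \<le> s < 1\<close> this is the limit of \<open>s ^ k\<close> as the exponent increases to the given one,
  which is why an infinite exponent gives \<open>0\<close>.\<close>

definition epow :: "real \<Rightarrow> enat \<Rightarrow> real" where
  "epow s k = (case k of enat n \<Rightarrow> s ^ n | \<infinity> \<Rightarrow> 0)"

lemma (in prob_space) pgf_sums:
  fixes K :: "'a \<Rightarrow> enat"
  assumes K [measurable]: "\<And>n. {\<omega> \<in> space M. K \<omega> = enat n} \<in> events"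
    and s: "0 \<le> s" "s \<le> 1"
  shows "(\<lambda>n. prob {\<omega> \<in> space M. K \<omega> = enat n} * s ^ n) sums expectation (\<lambda>\<omega>. epow s (K \<omega>))"
proof -
  define A where "A n = {\<omega> \<in> space M. K \<omega> = enat n}" for n
  have [measurable]: "A n \<in> events" for n
    using K by (simp add: A_def)
  define F where "F k \<omega> = (\<Sum>n<k. s ^ n * indicat_real (A n) \<omega>)" for k \<omega>
  have F_enat: "F k \<omega> = (if n < k then s ^ n else 0)" if "\<omega> \<in> space M" "K \<omega> = enat n" for k n \<omega>
  proof -
    have "F k \<omega> = (\<Sum>m<k. if m = n then s ^ n else 0)"
      unfolding F_def by (intro sum.cong) (use that in \<open>auto simp: A_def indicator_def\<close>)
    then show ?thesis
      by simp
  qed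
  have F_inf: "F k \<omega> = 0" if "K \<omega> = \<infinity>" for k \<omega>
    using that by (auto simp: F_def A_def)
  have lim: "(\<lambda>k. F k \<omega>) \<longlonglongrightarrow> epow s (K \<omega>)" if "\<omega> \<in> space M" for \<omega>
  proof (cases "K \<omega>")
    case (enat n)
    have "eventually (\<lambda>k. F k \<omega> = s ^ n) sequentially"
      using eventually_gt_at_top[of n] by eventually_elim (simp add: F_enat[OF that enat])
    with enat show ?thesis
      by (simp add: epow_def tendsto_eventually)
  next
    case infinity
    then show ?thesis
      by (simp add: epow_def F_inf)
  qed
  have bnd: "norm (F k \<omega>) \<le> 1" if "\<omega> \<in> space M" for k \<omega>
    by (cases "K \<omega>") (use s that in \<open>auto simp: F_enat F_inf power_le_one\<close>)
  have [measurable]: "F k \<in> borel_measurable M" for k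
    unfolding F_def by measurable
  have "(\<lambda>k. expectation (F k)) \<longlonglongrightarrow> expectation (\<lambda>\<omega>. epow s (K \<omega>))"
  proof (rule integral_dominated_convergence[where w="\<lambda>_. 1"])
    show "(\<lambda>\<omega>. epow s (K \<omega>)) \<in> borel_measurable M"
      by (rule borel_measurable_LIMSEQ_real[of _ F]) (use lim in auto)
  qed (use lim bnd in auto)
  moreover have "expectation (F k) = (\<Sum>n<k. prob (A n) * s ^ n)" for k
    unfolding F_def by (subst Bochner_Integration.integral_sum)
      (auto simp: mult.commute intro!: integrable_real_indicator simp: less_top[symmetric])
  ultimately show ?thesis
    by (simp add: sums_def A_def)
qed

lemma ecard_le_iff:
  "ecard A \<le> enat m \<longleftrightarrow> (\<exists>n\<le>m. ecard A = enat n)"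
  by (cases "ecard A") auto

lemma ecard_le_mono: "A \<subseteq> B \<Longrightarrow> ecard A \<le> ecard B"
  by (auto simp: ecard_def card_mono dest: finite_subset)

text \<open>A set of more than \<open>m\<close> elements already has a finite subset of more than \<open>m\<close> elements, and
  in an increasing union that subset lies in one of the sets.\<close>

lemma ecard_Union_le_iff:
  assumes "incseq A"
  shows "ecard (\<Union>l. A l) \<le> enat m \<longleftrightarrow> (\<forall>l. ecard (A l) \<le> enat m)"
proof (intro iffI allI)
  show "ecard (A l) \<le> enat m" if "ecard (\<Union>l. A l) \<le> enat m" for l
    by (rule order_trans[OF ecard_le_mono that]) auto
next
  assume le: "\<forall>l. ecard (A l) \<le> enat m"
  have "card T \<le> m" if T: "finite T" "T \<subseteq> (\<Union>l. A l)" for T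
  proof -
    have "A i \<subseteq> A j \<or> A j \<subseteq> A i" for i j
      using incseqD[OF assms] nat_le_linear[of i j] by blast
    then have "subset.chain UNIV (range A)"
      by (auto simp: subset_chain_def)
    then obtain B where "B \<in> range A" "T \<subseteq> B"
      using finite_subset_Union_chain[OF T] by blast
    then obtain l where "T \<subseteq> A l"
      by blast
    with le have "ecard T \<le> enat m"
      using ecard_le_mono order_trans by blast
    with T show ?thesis
      by (simp add: ecard_def)
  qed
  then have "finite (\<Union>l. A l) \<and> card (\<Union>l. A l) \<le> m"
    by (intro finite_if_finite_subsets_card_bdd) auto
  then show "ecard (\<Union>l. A l) \<le> enat m"
    by (simp add: ecard_def)
qed

text \<open>The set being counted is finite exactly when no index from some \<open>k\<close> on belongs to it, and then
  its cardinality is a finite sum of indicators.\<close>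

lemma ecard_event:
  assumes [measurable]: "\<And>i::nat. B i \<in> sets M"
  shows "{\<omega> \<in> space M. ecard {i. \<omega> \<in> B i} = enat n} \<in> sets M"
proof -
  have "ecard {i. \<omega> \<in> B i} = enat n \<longleftrightarrow>
     (\<exists>k. (\<forall>i\<in>{k..}. \<omega> \<notin> B i) \<and> card {i\<in>{..<k}. \<omega> \<in> B i} = n)" for \<omega>
  proof
    assume *: "ecard {i. \<omega> \<in> B i} = enat n"
    then have fin: "finite {i. \<omega> \<in> B i}" and card: "card {i. \<omega> \<in> B i} = n"
      by (auto simp: ecard_def split: if_splits)
    then obtain k where k: "\<And>i. \<omega> \<in> B i \<Longrightarrow> i < k"
      by (metis finite_nat_set_iff_bounded mem_Collect_eq)
    then have "{i\<in>{..<k}. \<omega> \<in> B i} = {i. \<omega> \<in> B i}"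
      by auto
    with k card have "(\<forall>i\<in>{k..}. \<omega> \<notin> B i) \<and> card {i\<in>{..<k}. \<omega> \<in> B i} = n"
      by (auto dest: leD)
    then show "\<exists>k. (\<forall>i\<in>{k..}. \<omega> \<notin> B i) \<and> card {i\<in>{..<k}. \<omega> \<in> B i} = n"
      by blast
  next
    assume "\<exists>k. (\<forall>i\<in>{k..}. \<omega> \<notin> B i) \<and> card {i\<in>{..<k}. \<omega> \<in> B i} = n"
    then obtain k where k: "\<forall>i\<in>{k..}. \<omega> \<notin> B i" "card {i\<in>{..<k}. \<omega> \<in> B i} = n"
      by blast
    have "{i. \<omega> \<in> B i} = {i\<in>{..<k}. \<omega> \<in> B i}"
      using k(1) by (auto intro: leI)
    with k(2) show "ecard {i. \<omega> \<in> B i} = enat n"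
      by (simp add: ecard_def)
  qed
  then have "{\<omega> \<in> space M. ecard {i. \<omega> \<in> B i} = enat n} =
     {\<omega> \<in> space M. \<exists>k. (\<forall>i\<in>{k..}. \<omega> \<notin> B i) \<and> (\<Sum>i<k. indicator (B i) \<omega>) = n}"
    by (simp add: sum.If_cases indicator_def Int_def)
  also have "\<dots> \<in> sets M"
    by measurable
  finally show ?thesis .
qed

lemma (in prob_space) prob_ecard_le:
  assumes [measurable]: "\<And>i::nat. B i \<in> events"
  shows "prob {\<omega> \<in> space M. ecard {i. \<omega> \<in> B i} \<le> enat m}
    = (\<Sum>n\<le>m. prob {\<omega> \<in> space M. ecard {i. \<omega> \<in> B i} = enat n})"
proof -
  have "{\<omega> \<in> space M. ecard {i. \<omega> \<in> B i} \<le> enat m}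
      = (\<Union>n\<in>{..m}. {\<omega> \<in> space M. ecard {i. \<omega> \<in> B i} = enat n})"
    by (auto simp: ecard_le_iff)
  also have "prob \<dots> = (\<Sum>n\<le>m. prob {\<omega> \<in> space M. ecard {i. \<omega> \<in> B i} = enat n})"
    by (rule finite_measure_finite_Union)
      (auto simp: disjoint_family_on_def intro!: ecard_event)
  finally show ?thesis .
qed

text \<open>The product over \<open>i < k\<close> is \<open>s\<close> to the power of the number of events \<open>B i\<close>, \<open>i < k\<close>, that
  occur, so its limit \<open>G\<close> is the generating function of the total count. The form
  \<open>s + (1 - s) * (1 - x)\<close> of the factors is chosen because \<open>1 - x\<close> will be a product over
  edges.\<close>

lemma (in prob_space) count_law:
  assumes [measurable]: "\<And>i::nat. B i \<in> events"
    and a: "\<And>s. 0 \<le> s \<Longrightarrow> s < 1 \<Longrightarrow> (\<lambda>n. a n * s ^ n) sums G s"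
    and lim: "\<And>s. 0 \<le> s \<Longrightarrow> s < 1 \<Longrightarrow>
      (\<lambda>k. expectation (\<lambda>\<omega>. \<Prod>i<k. s + (1 - s) * (1 - indicator (B i) \<omega>))) \<longlonglongrightarrow> G s"
  shows "prob {\<omega> \<in> space M. ecard {i. \<omega> \<in> B i} = enat n} = a n"
proof -
  define K where "K \<omega> = ecard {i. \<omega> \<in> B i}" for \<omega>
  have K: "{\<omega> \<in> space M. K \<omega> = enat n} \<in> events" for n
    unfolding K_def by (rule ecard_event) simp
  show ?thesis
    unfolding K_def[symmetric]
  proof (rule pgf_coeffs_unique[OF _ a])
    fix s :: real assume s: "0 \<le> s" "s < 1"
    define F where "F k \<omega> = (\<Prod>i<k. s + (1 - s) * (1 - indicat_real (B i) \<omega>))" for k \<omega>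
    have F: "F k \<omega> = s ^ card {i\<in>{..<k}. \<omega> \<in> B i}" for k \<omega>
    proof -
      have "F k \<omega> = (\<Prod>i<k. if \<omega> \<in> B i then s else 1)"
        unfolding F_def by (intro prod.cong) (auto simp: indicator_def)
      also have "\<dots> = s ^ card {i\<in>{..<k}. \<omega> \<in> B i}"
        by (subst prod.If_cases) (auto simp: Int_def)
      finally show ?thesis .
    qed
    have limF: "(\<lambda>k. F k \<omega>) \<longlonglongrightarrow> epow s (K \<omega>)" for \<omega>
    proof (cases "finite {i. \<omega> \<in> B i}")
      case True
      then obtain k where k: "\<And>i. \<omega> \<in> B i \<Longrightarrow> i < k"
        by (metis finite_nat_set_iff_bounded mem_Collect_eq)
      have "F l \<omega> = epow s (K \<omega>)" if "l \<ge> k" for l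
      proof -
        have "{i\<in>{..<l}. \<omega> \<in> B i} = {i. \<omega> \<in> B i}"
          using k that by force
        with True show ?thesis
          by (simp add: F K_def ecard_def epow_def)
      qed
      then show ?thesis
        by (intro tendsto_eventually) (auto simp: eventually_at_top_linorder)
    next
      case False
      have "filterlim (\<lambda>k. card {i\<in>{..<k}. \<omega> \<in> B i}) at_top sequentially"
        unfolding filterlim_at_top
      proof
        fix Z
        obtain T where T: "T \<subseteq> {i. \<omega> \<in> B i}" "finite T" "card T = Z"
          using infinite_arbitrarily_large[OF False] by metis
        then obtain k where k: "\<And>i. i \<in> T \<Longrightarrow> i < k"
          by (metis finite_nat_set_iff_bounded)
        have "Z \<le> card {i\<in>{..<l}. \<omega> \<in> B i}" if "l \<ge> k" for l
          unfolding T(3)[symmetric] by (rule card_mono) (use T(1) k that in force)+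
        then show "eventually (\<lambda>l. Z \<le> card {i\<in>{..<l}. \<omega> \<in> B i}) sequentially"
          by (auto simp: eventually_at_top_linorder)
      qed
      then have "(\<lambda>k. s ^ card {i\<in>{..<k}. \<omega> \<in> B i}) \<longlonglongrightarrow> 0"
        by (rule filterlim_compose[rotated]) (use s in \<open>simp add: LIMSEQ_power_zero\<close>)
      with False show ?thesis
        by (simp add: F K_def ecard_def epow_def)
    qed
    have [measurable]: "F k \<in> borel_measurable M" for k
      unfolding F_def by measurable
    have "(\<lambda>k. expectation (F k)) \<longlonglongrightarrow> expectation (\<lambda>\<omega>. epow s (K \<omega>))"
    proof (rule integral_dominated_convergence[where w="\<lambda>_. 1"])
      show "(\<lambda>\<omega>. epow s (K \<omega>)) \<in> borel_measurable M"
        by (rule borel_measurable_LIMSEQ_real[of _ F]) (use limF in auto)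
    qed (use limF s in \<open>auto simp: F power_le_one\<close>)
    with lim[OF s] have "expectation (\<lambda>\<omega>. epow s (K \<omega>)) = G s"
      unfolding F_def by (rule LIMSEQ_unique[rotated])
    with pgf_sums[of K s, OF K] s show "(\<lambda>n. prob {\<omega> \<in> space M. K \<omega> = enat n} * s ^ n) sums G s"
      by simp
  qed
qed

section \<open>The Laplace functional of a Poisson process\<close>

lemma (in prob_space) prob_eq_pmf:
  assumes N: "N \<in> measurable M (count_space UNIV)"
    and distr: "distr M (count_space UNIV) N = measure_pmf p"
  shows "prob {\<omega> \<in> space M. N \<omega> = n} = pmf p n"
proof -
  have "pmf p n = measure (distr M (count_space UNIV) N) {n}"
    by (simp add: distr pmf.rep_eq)
  also have "\<dots> = prob {\<omega> \<in> space M. N \<omega> = n}"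
    using N by (subst measure_distr) (auto intro!: arg_cong[where f=prob])
  finally show ?thesis ..
qed

lemma (in prob_space) expectation_power_poisson:
  assumes N: "N \<in> measurable M (count_space UNIV)"
    and distr: "distr M (count_space UNIV) N = measure_pmf p"
    and p: "\<And>n. pmf p n = pois r n"
    and z: "0 \<le> z" "z \<le> 1"
  shows "expectation (\<lambda>\<omega>. z ^ N \<omega>) = exp (- ((1 - z) * r))"
proof -
  have N_eq: "prob {\<omega> \<in> space M. N \<omega> = n} = pois r n" for n
    unfolding p[symmetric] by (rule prob_eq_pmf[OF N distr])
  have "{\<omega> \<in> space M. enat (N \<omega>) = enat n} \<in> events" for n
    using N by simp
  from pgf_sums[OF this z] have "(\<lambda>n. pois r n * z ^ n) sums expectation (\<lambda>\<omega>. z ^ N \<omega>)"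
    by (simp add: N_eq epow_def)
  with pois_pgf show ?thesis
    by (rule sums_unique2[rotated])
qed

lemma nn_integral_poisson_law:
  assumes "0 \<le> r"
  shows "(\<integral>\<^sup>+n. of_nat n \<partial>measure_pmf (poisson_law r)) = ennreal r"
proof -
  have "(\<lambda>n. real (Suc n) * pois r (Suc n)) sums r"
  proof -
    have "(\<lambda>n. r * pois r n) sums (r * 1)"
      by (intro sums_mult pois_sums_1)
    moreover have "r * pois r n = real (Suc n) * pois r (Suc n)" for n
      by (simp add: pois_def divide_simps del: of_nat_Suc)
    ultimately show ?thesis
      by simp
  qed
  then have sums: "(\<lambda>n. real n * pois r n) sums r"
    by (subst (asm) sums_Suc_iff) simp
  have "(\<integral>\<^sup>+n. of_nat n \<partial>measure_pmf (poisson_law r)) = (\<Sum>n. ennreal (real n * pois r n))"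
    unfolding nn_integral_measure_pmf nn_integral_count_space_nat
    by (intro suminf_cong)
      (use assms in \<open>simp add: pmf_poisson_law ennreal_mult pois_nonneg ennreal_of_nat_eq_real_of_nat mult.commute\<close>)
  also have "\<dots> = ennreal r"
    by (rule suminf_ennreal_eq) (use sums assms pois_nonneg in auto)
  finally show ?thesis .
qed

lemma points_Int: "points X \<omega> \<inter> A = (\<lambda>i. X i \<omega>) ` {i. X i \<omega> \<in> A}"
  by (auto simp: points_def)

lemma finite_points_Int_iff:
  assumes "inj (\<lambda>i. X i \<omega>)"
  shows "finite (points X \<omega> \<inter> A) \<longleftrightarrow> finite {i. X i \<omega> \<in> A}"
  unfolding points_Int by (rule finite_image_iff) (use assms in \<open>auto intro: inj_on_subset\<close>)

lemma card_points_Int: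
  assumes "inj (\<lambda>i. X i \<omega>)"
  shows "card (points X \<omega> \<inter> A) = card {i. X i \<omega> \<in> A}"
  unfolding points_Int by (rule card_image) (use assms in \<open>auto intro: inj_on_subset\<close>)

lemma poisson_process_measurable:
  "poisson_process M c X \<Longrightarrow> X i \<in> borel_measurable M"
  by (simp add: poisson_process_def)

lemma poisson_process_counts:
  assumes "poisson_process M c X" "A \<in> sets borel" "emeasure lborel A < \<infinity>"
  shows "AE \<omega> in M. finite (points X \<omega> \<inter> A)"
    and "(\<lambda>\<omega>. card (points X \<omega> \<inter> A)) \<in> measurable M (count_space UNIV)"
    and "distr M (count_space UNIV) (\<lambda>\<omega>. card (points X \<omega> \<inter> A))
      = measure_pmf (poisson_law (c * measure lborel A))"
  using assms unfolding poisson_process_def by blast+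

lemma poisson_process_inj:
  "poisson_process M c X \<Longrightarrow> AE \<omega> in M. inj (\<lambda>i. X i \<omega>)"
  by (simp add: poisson_process_def)

text \<open>Campbell's formula. Summing the laws of the points gives a measure on the space whose value on a
  set of finite volume is the mean number of points in it, that is \<open>c\<close> times the volume. Hence
  it is \<open>c\<close> times Lebesgue measure, which is determined by its values on boxes.\<close>

lemma campbell:
  fixes X :: "nat \<Rightarrow> 'w \<Rightarrow> 'a::euclidean_space"
  assumes "prob_space M" and X: "poisson_process M c X" and c: "c > 0"
    and h [measurable]: "h \<in> borel_measurable borel"
  shows "(\<Sum>i. \<integral>\<^sup>+\<omega>. h (X i \<omega>) \<partial>M) = c * (\<integral>\<^sup>+x. h x \<partial>lborel)"
proof -
  interpret prob_space M by fact
  note [measurable] = poisson_process_measurable[OF X]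
  define \<kappa> where "\<kappa> = distr (count_space UNIV \<Otimes>\<^sub>M M) borel (\<lambda>(i, \<omega>). X i \<omega>)"
  have [measurable]: "(\<lambda>(i, \<omega>). X i \<omega>) \<in> borel_measurable (count_space UNIV \<Otimes>\<^sub>M M)"
    by (intro measurable_pair_measure_countable1) auto
  have int_\<kappa>: "(\<integral>\<^sup>+x. f x \<partial>\<kappa>) = (\<Sum>i. \<integral>\<^sup>+\<omega>. f (X i \<omega>) \<partial>M)" if [measurable]: "f \<in> borel_measurable borel" for f
  proof -
    have "(\<integral>\<^sup>+x. f x \<partial>\<kappa>) = (\<integral>\<^sup>+p. f (case p of (i, \<omega>) \<Rightarrow> X i \<omega>) \<partial>(count_space UNIV \<Otimes>\<^sub>M M))"
      unfolding \<kappa>_def by (rule nn_integral_distr) auto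
    also have "\<dots> = (\<integral>\<^sup>+i. \<integral>\<^sup>+\<omega>. f (X i \<omega>) \<partial>M \<partial>count_space UNIV)"
      by (subst nn_integral_fst[symmetric]) auto
    finally show ?thesis
      by (simp add: nn_integral_count_space_nat)
  qed
  have \<kappa>_finite: "emeasure \<kappa> A = ennreal (c * measure lborel A)"
    if A [measurable]: "A \<in> sets borel" and fin: "emeasure lborel A < \<infinity>" for A
  proof -
    note inj = poisson_process_inj[OF X] and finite = poisson_process_counts(1)[OF X A fin]
      and [measurable] = poisson_process_counts(2)[OF X A fin]
      and distr = poisson_process_counts(3)[OF X A fin]
    have "emeasure \<kappa> A = (\<integral>\<^sup>+x. indicator A x \<partial>\<kappa>)"
      by (simp add: \<kappa>_def)
    also have "\<dots> = (\<integral>\<^sup>+\<omega>. (\<Sum>i. indicator A (X i \<omega>)) \<partial>M)"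
      by (subst int_\<kappa>) (auto intro!: nn_integral_suminf[symmetric])
    also have "\<dots> = (\<integral>\<^sup>+\<omega>. of_nat (card (points X \<omega> \<inter> A)) \<partial>M)"
    proof (rule nn_integral_cong_AE, use inj finite in eventually_elim)
      fix \<omega> assume *: "inj (\<lambda>i. X i \<omega>)" "finite (points X \<omega> \<inter> A)"
      then have "(\<Sum>i. indicator A (X i \<omega>) :: ennreal) = (\<Sum>i | X i \<omega> \<in> A. indicator A (X i \<omega>))"
        by (intro suminf_finite) (auto simp: finite_points_Int_iff)
      also have "\<dots> = of_nat (card (points X \<omega> \<inter> A))"
        using * by (simp add: card_points_Int)
      finally show "(\<Sum>i. indicator A (X i \<omega>) :: ennreal) = of_nat (card (points X \<omega> \<inter> A))" .
    qed
    also have "\<dots> = (\<integral>\<^sup>+n. of_nat n \<partial>distr M (count_space UNIV) (\<lambda>\<omega>. card (points X \<omega> \<inter> A)))"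
      by (subst nn_integral_distr) auto
    also have "\<dots> = ennreal (c * measure lborel A)"
      unfolding distr by (rule nn_integral_poisson_law) (use c in simp)
    finally show ?thesis .
  qed
  \<comment> \<open>Rescaling \<open>\<kappa>\<close> to unit intensity allows the characterisation of Lebesgue measure by boxes.\<close>
  have "lborel = density \<kappa> (\<lambda>_. ennreal (1 / c))"
  proof (rule lborel_eqI)
    fix l u :: 'a assume le: "\<And>b. b \<in> Basis \<Longrightarrow> l \<bullet> b \<le> u \<bullet> b"
    have "emeasure \<kappa> (box l u) = ennreal (c * measure lborel (box l u))"
      by (rule \<kappa>_finite) (auto simp: emeasure_lborel_box_eq)
    then show "emeasure (density \<kappa> (\<lambda>_. ennreal (1 / c))) (box l u) = (\<Prod>b\<in>Basis. (u - l) \<bullet> b)"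
      using le c by (simp add: emeasure_density_const \<kappa>_def ennreal_mult'[symmetric] measure_lborel_box_eq)
  qed (simp add: \<kappa>_def)
  then have "(\<integral>\<^sup>+x. h x \<partial>lborel) = (\<integral>\<^sup>+x. h x \<partial>density \<kappa> (\<lambda>_. ennreal (1 / c)))"
    by simp
  also have "\<dots> = ennreal (1 / c) * (\<integral>\<^sup>+x. h x \<partial>\<kappa>)"
    by (subst nn_integral_density) (auto simp: \<kappa>_def nn_integral_cmult)
  finally have "c * (\<integral>\<^sup>+x. h x \<partial>lborel) = (ennreal c * ennreal (1 / c)) * (\<integral>\<^sup>+x. h x \<partial>\<kappa>)"
    by (simp add: mult.assoc)
  also have "ennreal c * ennreal (1 / c) = 1"
    using c by (simp add: ennreal_mult[symmetric])
  finally show ?thesis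
    by (simp add: int_\<kappa>)
qed

lemma campbell_le:
  fixes X :: "nat \<Rightarrow> 'w \<Rightarrow> 'a::euclidean_space" and h :: "'a \<Rightarrow> real"
  assumes M: "prob_space M" and X: "poisson_process M c X" and c: "c > 0"
    and h: "integrable lborel h" "\<And>x. 0 \<le> h x" "\<And>x. h x \<le> 1"
  shows "(\<Sum>i<k. \<integral>\<omega>. h (X i \<omega>) \<partial>M) \<le> c * (\<integral>x. h x \<partial>lborel)"
proof -
  interpret prob_space M by fact
  note [measurable] = poisson_process_measurable[OF X]
  have [measurable]: "h \<in> borel_measurable borel"
    using h(1) by simp
  have "ennreal (\<integral>\<omega>. h (X i \<omega>) \<partial>M) = (\<integral>\<^sup>+\<omega>. h (X i \<omega>) \<partial>M)" for i
    using h by (intro nn_integral_eq_integral[symmetric] integrable_const_bound[where B=1]) auto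
  then have "ennreal (\<Sum>i<k. \<integral>\<omega>. h (X i \<omega>) \<partial>M) = (\<Sum>i<k. \<integral>\<^sup>+\<omega>. h (X i \<omega>) \<partial>M)"
    using h by (simp add: sum_ennreal[symmetric] integral_nonneg)
  also have "\<dots> \<le> (\<Sum>i. \<integral>\<^sup>+\<omega>. h (X i \<omega>) \<partial>M)"
    by (rule sum_le_suminf) auto
  also have "\<dots> = c * (\<integral>\<^sup>+x. h x \<partial>lborel)"
    by (rule campbell[OF M X c]) auto
  also have "\<dots> = ennreal (c * (\<integral>x. h x \<partial>lborel))"
    using h c by (subst nn_integral_eq_integral) (auto simp: ennreal_mult integral_nonneg)
  finally show ?thesis
    using h c by (subst (asm) ennreal_le_iff) (auto intro!: integral_nonneg)
qed

text \<open>The Laplace functional of a step function. A point in \<open>A a\<close> contributes the factor \<open>z a\<close>, so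
  the product over all points is the product of the powers \<open>z a ^ N a\<close>, where \<open>N a\<close> counts the
  points in \<open>A a\<close>. As the sets are disjoint, these counts are independent and Poisson distributed.\<close>

lemma laplace_step:
  fixes X :: "nat \<Rightarrow> 'w \<Rightarrow> 'a::euclidean_space" and A :: "nat \<Rightarrow> 'a set"
  assumes M: "prob_space M" and X: "poisson_process M c X" and c: "c > 0"
    and A: "\<And>a. a < n \<Longrightarrow> A a \<in> sets borel" "\<And>a. a < n \<Longrightarrow> emeasure lborel (A a) < \<infinity>"
    and disj: "disjoint_family_on A {..<n}"
    and z: "\<And>a. a < n \<Longrightarrow> 0 \<le> z a" "\<And>a. a < n \<Longrightarrow> z a \<le> 1"
  shows "(\<lambda>k. \<integral>\<omega>. (\<Prod>i<k. \<Prod>a<n. if X i \<omega> \<in> A a then z a else 1) \<partial>M)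
    \<longlonglongrightarrow> exp (- (c * (\<Sum>a<n. (1 - z a) * measure lborel (A a))))"
proof -
  interpret prob_space M by fact
  note [measurable] = poisson_process_measurable[OF X]
  define N where "N a \<omega> = card (points X \<omega> \<inter> A a)" for a \<omega>
  have N [measurable]: "N a \<in> measurable M (count_space UNIV)" if "a < n" for a
    unfolding N_def by (rule poisson_process_counts[OF X A[OF that]])
  have indep: "indep_vars (\<lambda>_. count_space UNIV) N {..<n}"
    using X A disj unfolding poisson_process_def N_def by blast
  note inj = poisson_process_inj[OF X]
  have "AE \<omega> in M. \<forall>a\<in>{..<n}. finite (points X \<omega> \<inter> A a)"
    by (intro eventually_ball_finite ballI) (simp_all add: poisson_process_counts(1)[OF X A])
  then have lim: "AE \<omega> in M. (\<lambda>k. \<Prod>i<k. \<Prod>a<n. if X i \<omega> \<in> A a then z a else 1) \<longlonglongrightarrow> (\<Prod>a<n. z a ^ N a \<omega>)"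
    using inj
  proof eventually_elim
    case (elim \<omega>)
    have "(\<lambda>k. \<Prod>i<k. if X i \<omega> \<in> A a then z a else 1) \<longlonglongrightarrow> z a ^ N a \<omega>" if a: "a < n" for a
    proof -
      have fin: "finite {i. X i \<omega> \<in> A a}"
        using elim a by (simp add: finite_points_Int_iff)
      then obtain k0 where k0: "\<And>i. X i \<omega> \<in> A a \<Longrightarrow> i < k0"
        by (auto simp: finite_nat_iff_bounded)
      have "(\<Prod>i<k. if X i \<omega> \<in> A a then z a else 1) = z a ^ N a \<omega>" if "k \<ge> k0" for k
      proof -
        have "{..<k} \<inter> {i. X i \<omega> \<in> A a} = {i. X i \<omega> \<in> A a}"
          using k0 that by force
        then show ?thesis
          using elim by (simp add: prod.If_cases N_def card_points_Int)
      qed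
      then show ?thesis
        by (intro tendsto_eventually) (auto simp: eventually_at_top_linorder)
    qed
    then have "(\<lambda>k. \<Prod>a<n. \<Prod>i<k. if X i \<omega> \<in> A a then z a else 1) \<longlonglongrightarrow> (\<Prod>a<n. z a ^ N a \<omega>)"
      by (intro tendsto_prod) auto
    then show ?case
      by (subst prod.swap)
  qed
  have [measurable]: "(\<lambda>\<omega>. if X i \<omega> \<in> A a then z a else 1) \<in> borel_measurable M" if "a < n" for i a
    using A(1)[OF that] by measurable
  have "(\<lambda>k. \<integral>\<omega>. (\<Prod>i<k. \<Prod>a<n. if X i \<omega> \<in> A a then z a else 1) \<partial>M) \<longlonglongrightarrow> (\<integral>\<omega>. (\<Prod>a<n. z a ^ N a \<omega>) \<partial>M)"
  proof (rule integral_dominated_convergence[where w="\<lambda>_. 1"])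
    show "AE \<omega> in M. norm (\<Prod>i<k. \<Prod>a<n. if X i \<omega> \<in> A a then z a else 1) \<le> 1" for k
      using z by (intro AE_I2) (auto simp: abs_prod intro!: prod_le_1 prod_nonneg)
    show "(\<lambda>\<omega>. \<Prod>i<k. \<Prod>a<n. if X i \<omega> \<in> A a then z a else 1) \<in> borel_measurable M" for k
      by (intro borel_measurable_prod) auto
    show "(\<lambda>\<omega>. \<Prod>a<n. z a ^ N a \<omega>) \<in> borel_measurable M"
    proof (intro borel_measurable_prod)
      fix a assume "a \<in> {..<n}"
      then show "(\<lambda>\<omega>. z a ^ N a \<omega>) \<in> borel_measurable M"
        using measurable_compose[OF N, of a "\<lambda>k. z a ^ k" borel] by simp
    qed
  qed (use lim in auto)
  also have "(\<integral>\<omega>. (\<Prod>a<n. z a ^ N a \<omega>) \<partial>M) = (\<Prod>a<n. \<integral>\<omega>. z a ^ N a \<omega> \<partial>M)"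
  proof (rule indep_vars_lebesgue_integral)
    show "indep_vars (\<lambda>_. borel) (\<lambda>a \<omega>. z a ^ N a \<omega>) {..<n}"
      by (rule indep_vars_compose2[OF indep]) auto
    show "integrable M (\<lambda>\<omega>. z a ^ N a \<omega>)" if "a \<in> {..<n}" for a
      using measurable_compose[OF N, of a "\<lambda>k. z a ^ k" borel] that z
      by (intro integrable_const_bound[where B=1]) (auto simp: power_le_one)
  qed simp
  also have "\<dots> = (\<Prod>a<n. exp (- ((1 - z a) * (c * measure lborel (A a)))))"
  proof (rule prod.cong)
    fix a assume "a \<in> {..<n}"
    then have a: "a < n" by simp
    have "distr M (count_space UNIV) (N a) = measure_pmf (poisson_law (c * measure lborel (A a)))"
      unfolding N_def by (rule poisson_process_counts[OF X A[OF a]])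
    then show "(\<integral>\<omega>. z a ^ N a \<omega> \<partial>M) = exp (- ((1 - z a) * (c * measure lborel (A a))))"
      using z[OF a] c by (intro expectation_power_poisson[OF N[OF a]]) (auto simp: pmf_poisson_law)
  qed simp
  also have "\<dots> = exp (- (c * (\<Sum>a<n. (1 - z a) * measure lborel (A a))))"
    by (simp add: exp_sum[symmetric] sum_negf sum_distrib_left mult.left_commute)
  finally show ?thesis .
qed

text \<open>Step functions \<open>fm m\<close> that round \<open>f\<close> down to multiples of \<open>1 / Suc m\<close> reduce the claim to the
  previous lemma. The error is at most the mean of the sum of \<open>f - fm m\<close> over the points, since
  products of numbers in \<open>[0, 1]\<close> differ by at most the sum of the differences of their factors.
  By Campbell's formula this is \<open>c\<close> times the integral of \<open>f - fm m\<close>, uniformly in the number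
  \<open>k\<close> of factors, so that the limits in \<open>k\<close> and \<open>m\<close> may be exchanged.\<close>

lemma laplace_functional:
  fixes X :: "nat \<Rightarrow> 'w \<Rightarrow> 'a::euclidean_space" and f :: "'a \<Rightarrow> real"
  assumes M: "prob_space M" and X: "poisson_process M c X" and c: "c > 0"
    and f: "integrable lborel f" "\<And>x. 0 \<le> f x" "\<And>x. f x \<le> 1"
  shows "(\<lambda>k. \<integral>\<omega>. (\<Prod>i<k. 1 - f (X i \<omega>)) \<partial>M) \<longlonglongrightarrow> exp (- (c * (\<integral>x. f x \<partial>lborel)))"
proof -
  interpret prob_space M by fact
  note [measurable] = poisson_process_measurable[OF X]
  have f_meas [measurable]: "f \<in> borel_measurable borel"
    using f(1) by simp
  define fm where "fm m x = of_int \<lfloor>real (Suc m) * f x\<rfloor> / real (Suc m)" for m x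
  have [measurable]: "fm m \<in> borel_measurable borel" for m
    unfolding fm_def by measurable
  have fm_nonneg: "0 \<le> fm m x" for m x
    using f by (simp add: fm_def)
  have fm_le: "fm m x \<le> f x" for m x
    unfolding fm_def using of_int_floor_le[of "real (Suc m) * f x"] by (simp add: divide_simps mult.commute)
  have fm_ge: "f x - 1 / real (Suc m) \<le> fm m x" for m x
  proof -
    have "real (Suc m) * f x - 1 \<le> of_int \<lfloor>real (Suc m) * f x\<rfloor>"
      by linarith
    then have "(real (Suc m) * f x - 1) / real (Suc m) \<le> fm m x"
      unfolding fm_def by (rule divide_right_mono) simp
    then show ?thesis
      by (simp add: diff_divide_distrib)
  qed
  have fm_int: "integrable lborel (fm m)" for m
    using f fm_nonneg fm_le by (intro Bochner_Integration.integrable_bound[OF f(1)]) auto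
  define L where "L m = exp (- (c * (\<integral>x. fm m x \<partial>lborel)))" for m
  have step: "(\<lambda>k. \<integral>\<omega>. (\<Prod>i<k. 1 - fm m (X i \<omega>)) \<partial>M) \<longlonglongrightarrow> L m" for m
  proof -
    \<comment> \<open>The level where \<open>fm m\<close> vanishes may have infinite volume, so levels are counted from \<open>1\<close>:
      \<open>A a\<close> is the set where \<open>fm m\<close> equals \<open>Suc a / Suc m\<close>.\<close>
    define A where "A a = {x. \<lfloor>real (Suc m) * f x\<rfloor> = int (Suc a)}" for a
    define z where "z a = 1 - real (Suc a) / real (Suc m)" for a
    have A [measurable]: "A a \<in> sets borel" for a
      unfolding A_def by measurable
    have level: "x \<in> A a \<longleftrightarrow> nat \<lfloor>real (Suc m) * f x\<rfloor> = Suc a" for x a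
      using f(2)[of x] unfolding A_def by (simp add: nat_eq_iff)
    have level_le: "nat \<lfloor>real (Suc m) * f x\<rfloor> \<le> Suc m" for x
    proof -
      have "real (Suc m) * f x \<le> real (Suc m) * 1"
        using f by (intro mult_left_mono) auto
      then have "\<lfloor>real (Suc m) * f x\<rfloor> \<le> \<lfloor>real (Suc m) * 1\<rfloor>"
        by (rule floor_mono)
      also have "\<dots> = int (Suc m)"
        unfolding mult_1_right floor_of_nat ..
      finally show ?thesis
        by (simp add: nat_le_iff)
    qed
    have fm_nat: "fm m x = real (nat \<lfloor>real (Suc m) * f x\<rfloor>) / real (Suc m)" for x
      using f(2)[of x] unfolding fm_def by (simp add: of_nat_nat)
    have 1: "1 - fm m x = (\<Prod>a<Suc m. if x \<in> A a then z a else 1)"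
      and 2: "fm m x = (\<Sum>a<Suc m. (1 - z a) * indicator (A a) x)" for x
    proof -
      show "1 - fm m x = (\<Prod>a<Suc m. if x \<in> A a then z a else 1)"
      proof (cases "nat \<lfloor>real (Suc m) * f x\<rfloor>")
        case 0
        then show ?thesis by (simp add: fm_nat level del: of_nat_Suc)
      next
        case (Suc v)
        have "v < Suc m" using level_le[of x] Suc by simp
        have "(\<Prod>a<Suc m. if x \<in> A a then z a else 1) = (\<Prod>a<Suc m. if v = a then z a else 1)"
          unfolding level Suc by simp
        also have "\<dots> = z v"
          using \<open>v < Suc m\<close> by (subst prod.delta') auto
        finally show ?thesis
          by (simp add: fm_nat Suc z_def del: of_nat_Suc)
      qed
      show "fm m x = (\<Sum>a<Suc m. (1 - z a) * indicator (A a) x)"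
      proof (cases "nat \<lfloor>real (Suc m) * f x\<rfloor>")
        case 0
        then show ?thesis by (simp add: fm_nat level indicator_def del: of_nat_Suc)
      next
        case (Suc v)
        have "v < Suc m" using level_le[of x] Suc by simp
        have "(\<Sum>a<Suc m. (1 - z a) * indicator (A a) x) = (\<Sum>a<Suc m. if v = a then 1 - z a else 0)"
          unfolding level Suc indicator_def by (intro sum.cong) auto
        also have "\<dots> = 1 - z v"
          using \<open>v < Suc m\<close> by (subst sum.delta') auto
        finally show ?thesis
          by (simp add: fm_nat Suc z_def del: of_nat_Suc)
      qed
    qed
    have A_int: "integrable lborel (indicat_real (A a))" for a
    proof (rule Bochner_Integration.integrable_bound)
      show "integrable lborel (\<lambda>x. real (Suc m) * f x)"
        using f by simp
      have "1 \<le> real (Suc m) * f x" if "x \<in> A a" for x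
        using that by (simp add: A_def floor_eq_iff)
      then show "AE x in lborel. norm (indicat_real (A a) x) \<le> norm (real (Suc m) * f x)"
        using f by (intro AE_I2) (auto simp: indicator_def simp del: of_nat_Suc)
    qed simp
    have A_fin: "emeasure lborel (A a) < \<infinity>" for a
      using A_int[of a] by (subst (asm) integrable_indicator_iff) auto
    have "(\<lambda>k. \<integral>\<omega>. (\<Prod>i<k. 1 - fm m (X i \<omega>)) \<partial>M)
      \<longlonglongrightarrow> exp (- (c * (\<Sum>a<Suc m. (1 - z a) * measure lborel (A a))))"
      unfolding 1
    proof (rule laplace_step[OF M X c A A_fin])
      show "disjoint_family_on A {..<Suc m}"
        by (auto simp: disjoint_family_on_def A_def)
    qed (auto simp: z_def divide_simps)
    also have "(\<Sum>a<Suc m. (1 - z a) * measure lborel (A a)) = (\<integral>x. fm m x \<partial>lborel)"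
      unfolding 2 using A_int by (subst Bochner_Integration.integral_sum) auto
    finally show ?thesis
      unfolding L_def .
  qed
  define \<delta> where "\<delta> m = c * (\<integral>x. f x - fm m x \<partial>lborel)" for m
  have diff: "\<bar>(\<integral>\<omega>. (\<Prod>i<k. 1 - f (X i \<omega>)) \<partial>M) - (\<integral>\<omega>. (\<Prod>i<k. 1 - fm m (X i \<omega>)) \<partial>M)\<bar> \<le> \<delta> m" for k m
  proof -
    have bnd: "0 \<le> 1 - f x" "1 - f x \<le> 1" "0 \<le> 1 - fm m x" "1 - fm m x \<le> 1" "f x - fm m x \<le> 1" for x
      using f(2,3)[of x] fm_nonneg[of m x] fm_le[of m x] by auto
    have int: "integrable M (\<lambda>\<omega>. \<Prod>i<k. 1 - f (X i \<omega>))" "integrable M (\<lambda>\<omega>. \<Prod>i<k. 1 - fm m (X i \<omega>))"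
      using bnd by (auto intro!: integrable_const_bound[where B=1] AE_I2 prod_le_1 simp: abs_prod)
    have int': "integrable M (\<lambda>\<omega>. f (X i \<omega>) - fm m (X i \<omega>))" for i
      using bnd fm_le by (auto intro!: integrable_const_bound[where B=1])
    have "\<bar>(\<integral>\<omega>. (\<Prod>i<k. 1 - f (X i \<omega>)) \<partial>M) - (\<integral>\<omega>. (\<Prod>i<k. 1 - fm m (X i \<omega>)) \<partial>M)\<bar>
      = \<bar>\<integral>\<omega>. (\<Prod>i<k. 1 - f (X i \<omega>)) - (\<Prod>i<k. 1 - fm m (X i \<omega>)) \<partial>M\<bar>"
      using int by simp
    also have "\<dots> \<le> (\<integral>\<omega>. \<bar>(\<Prod>i<k. 1 - f (X i \<omega>)) - (\<Prod>i<k. 1 - fm m (X i \<omega>))\<bar> \<partial>M)"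
      by (rule integral_abs_bound)
    also have "\<dots> \<le> (\<integral>\<omega>. (\<Sum>i<k. f (X i \<omega>) - fm m (X i \<omega>)) \<partial>M)"
    proof (rule integral_mono)
      fix \<omega>
      have "norm ((\<Prod>i<k. 1 - f (X i \<omega>)) - (\<Prod>i<k. 1 - fm m (X i \<omega>)))
        \<le> (\<Sum>i<k. norm ((1 - f (X i \<omega>)) - (1 - fm m (X i \<omega>))))"
        using bnd by (intro norm_prod_diff) auto
      then show "\<bar>(\<Prod>i<k. 1 - f (X i \<omega>)) - (\<Prod>i<k. 1 - fm m (X i \<omega>))\<bar> \<le> (\<Sum>i<k. f (X i \<omega>) - fm m (X i \<omega>))"
        using fm_le by (simp add: abs_minus_commute)
    qed (use int int' in auto)
    also have "\<dots> = (\<Sum>i<k. \<integral>\<omega>. f (X i \<omega>) - fm m (X i \<omega>) \<partial>M)"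
      using int' by (rule Bochner_Integration.integral_sum)
    also have "\<dots> \<le> \<delta> m"
      unfolding \<delta>_def using f fm_int fm_le bnd by (intro campbell_le[OF M X c]) auto
    finally show ?thesis .
  qed
  have fm_lim: "(\<lambda>m. fm m x) \<longlonglongrightarrow> f x" for x
  proof (rule tendsto_sandwich)
    show "(\<lambda>m. f x - 1 / real (Suc m)) \<longlonglongrightarrow> f x"
      using tendsto_diff[OF tendsto_const LIMSEQ_inverse_real_of_nat, of "f x"] by (simp add: inverse_eq_divide)
  qed (use fm_ge fm_le in auto)
  have int_lim: "(\<lambda>m. \<integral>x. fm m x \<partial>lborel) \<longlonglongrightarrow> (\<integral>x. f x \<partial>lborel)"
    by (rule integral_dominated_convergence[where w=f]) (use f fm_lim fm_nonneg fm_le in auto)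
  have L_lim: "L \<longlonglongrightarrow> exp (- (c * (\<integral>x. f x \<partial>lborel)))"
    unfolding L_def by (intro tendsto_intros int_lim)
  have \<delta>_lim: "\<delta> \<longlonglongrightarrow> 0"
  proof -
    have "(\<lambda>m. c * ((\<integral>x. f x \<partial>lborel) - (\<integral>x. fm m x \<partial>lborel))) \<longlonglongrightarrow> c * ((\<integral>x. f x \<partial>lborel) - (\<integral>x. f x \<partial>lborel))"
      by (intro tendsto_intros int_lim)
    then show ?thesis
      using f fm_int by (simp add: \<delta>_def[abs_def])
  qed
  show ?thesis
  proof (rule LIMSEQ_I)
    fix e :: real assume "e > 0"
    then have e: "e / 3 > 0" by simp
    have "eventually (\<lambda>m. dist (\<delta> m) 0 < e / 3 \<and> dist (L m) (exp (- (c * (\<integral>x. f x \<partial>lborel)))) < e / 3) sequentially"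
      by (intro eventually_conj tendstoD[OF \<delta>_lim e] tendstoD[OF L_lim e])
    then obtain m where m: "\<bar>\<delta> m\<bar> < e / 3" "\<bar>L m - exp (- (c * (\<integral>x. f x \<partial>lborel)))\<bar> < e / 3"
      by (auto simp: eventually_at_top_linorder dist_real_def)
    from tendstoD[OF step[of m] e] obtain k0
      where k0: "\<And>k. k \<ge> k0 \<Longrightarrow> \<bar>(\<integral>\<omega>. (\<Prod>i<k. 1 - fm m (X i \<omega>)) \<partial>M) - L m\<bar> < e / 3"
      by (auto simp: eventually_at_top_linorder dist_real_def)
    have "norm ((\<integral>\<omega>. (\<Prod>i<k. 1 - f (X i \<omega>)) \<partial>M) - exp (- (c * (\<integral>x. f x \<partial>lborel)))) < e" if "k \<ge> k0" for k
      using m diff[of k m] k0[OF that] unfolding real_norm_def by linarith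
    then show "\<exists>k0. \<forall>k\<ge>k0. norm ((\<integral>\<omega>. (\<Prod>i<k. 1 - f (X i \<omega>)) \<partial>M) - exp (- (c * (\<integral>x. f x \<partial>lborel)))) < e"
      by blast
  qed
qed

section \<open>Tools for conditioning\<close>

text \<open>Absent edges are reduced to present ones by inclusion and exclusion, one factor \<open>1 - e i\<close> at a
  time. Here \<open>e\<close> will be the indicators of edges and \<open>p\<close> their conditional probabilities.\<close>

lemma (in prob_space) expectation_mixed_products:
  fixes e p :: "'i \<Rightarrow> 'a \<Rightarrow> real"
  assumes meas [measurable]: "\<And>i. e i \<in> borel_measurable M" "\<And>i. p i \<in> borel_measurable M"
    and e: "\<And>i \<omega>. e i \<omega> \<in> {0..1}" and p: "\<And>i \<omega>. p i \<omega> \<in> {0..1}"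
    and eq: "\<And>S. finite S \<Longrightarrow> expectation (\<lambda>\<omega>. \<Prod>i\<in>S. e i \<omega>) = expectation (\<lambda>\<omega>. \<Prod>i\<in>S. p i \<omega>)"
    and fin: "finite S" "finite T" "S \<inter> T = {}"
  shows "expectation (\<lambda>\<omega>. (\<Prod>i\<in>S. e i \<omega>) * (\<Prod>i\<in>T. 1 - e i \<omega>))
    = expectation (\<lambda>\<omega>. (\<Prod>i\<in>S. p i \<omega>) * (\<Prod>i\<in>T. 1 - p i \<omega>))"
  using fin(2,1,3)
proof (induction T arbitrary: S rule: finite_induct)
  case empty
  then show ?case by (simp add: eq)
next
  case (insert t T)
  have int: "integrable M (\<lambda>\<omega>. (\<Prod>i\<in>A. q i \<omega>) * (\<Prod>i\<in>B. 1 - q i \<omega>))"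
    if [measurable]: "\<And>i. q i \<in> borel_measurable M" and q: "\<And>i \<omega>. q i \<omega> \<in> {0..1}"
    for q :: "'i \<Rightarrow> 'a \<Rightarrow> real" and A B
    using q by (intro integrable_const_bound[where B=1] AE_I2)
      (auto simp: abs_mult abs_prod intro!: mult_le_one prod_le_1 prod_nonneg)
  have split: "expectation (\<lambda>\<omega>. (\<Prod>i\<in>S. q i \<omega>) * (\<Prod>i\<in>insert t T. 1 - q i \<omega>))
      = expectation (\<lambda>\<omega>. (\<Prod>i\<in>S. q i \<omega>) * (\<Prod>i\<in>T. 1 - q i \<omega>))
      - expectation (\<lambda>\<omega>. (\<Prod>i\<in>insert t S. q i \<omega>) * (\<Prod>i\<in>T. 1 - q i \<omega>))"
    if [measurable]: "\<And>i. q i \<in> borel_measurable M" and q: "\<And>i \<omega>. q i \<omega> \<in> {0..1}"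
    for q :: "'i \<Rightarrow> 'a \<Rightarrow> real"
  proof -
    have "(\<Prod>i\<in>S. q i \<omega>) * (\<Prod>i\<in>insert t T. 1 - q i \<omega>)
        = (\<Prod>i\<in>S. q i \<omega>) * (\<Prod>i\<in>T. 1 - q i \<omega>) - (\<Prod>i\<in>insert t S. q i \<omega>) * (\<Prod>i\<in>T. 1 - q i \<omega>)" for \<omega>
      using insert by (simp add: algebra_simps)
    then show ?thesis
      using int[of q S T] int[of q "insert t S" T] q by simp
  qed
  show ?case
    using insert.IH[of S] insert.IH[of "insert t S"] insert.hyps insert.prems
    by (simp only: split[OF meas(1) e] split[OF meas(2) p]) auto
qed

lemma (in prob_space) expectation_indep_var:
  fixes f :: "'s \<times> 's \<Rightarrow> real"
  assumes indep: "indep_var S A T B"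
    and f [measurable]: "f \<in> borel_measurable (S \<Otimes>\<^sub>M T)" and bnd: "\<And>z. \<bar>f z\<bar> \<le> 1"
  shows "expectation (\<lambda>\<omega>. f (A \<omega>, B \<omega>)) = (\<integral>\<omega>'. \<integral>\<omega>. f (A \<omega>, B \<omega>') \<partial>M \<partial>M)"
proof -
  have [measurable]: "A \<in> measurable M S" "B \<in> measurable M T"
    and joint: "distr M S A \<Otimes>\<^sub>M distr M T B = distr M (S \<Otimes>\<^sub>M T) (\<lambda>\<omega>. (A \<omega>, B \<omega>))"
    using indep by (auto simp: indep_var_distribution_eq)
  interpret A: prob_space "distr M S A"
    by (rule prob_space_distr) simp
  interpret B: prob_space "distr M T B"
    by (rule prob_space_distr) simp
  interpret AB: pair_prob_space "distr M S A" "distr M T B" ..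
  have "expectation (\<lambda>\<omega>. f (A \<omega>, B \<omega>)) = (\<integral>z. f z \<partial>distr M (S \<Otimes>\<^sub>M T) (\<lambda>\<omega>. (A \<omega>, B \<omega>)))"
    by (subst integral_distr) auto
  also have "\<dots> = (\<integral>y. \<integral>x. f (x, y) \<partial>distr M S A \<partial>distr M T B)"
    unfolding joint[symmetric]
  proof -
    have "integrable (distr M S A \<Otimes>\<^sub>M distr M T B) (case_prod (\<lambda>x y. f (x, y)))"
      using bnd by (intro AB.integrable_const_bound[where B=1]) auto
    from AB.integral_snd[OF this]
    show "AB.expectation f = B.expectation (\<lambda>y. A.expectation (\<lambda>x. f (x, y)))"
      by simp
  qed
  also have "\<dots> = (\<integral>\<omega>'. \<integral>x. f (x, B \<omega>') \<partial>distr M S A \<partial>M)"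
    by (subst integral_distr) auto
  also have "\<dots> = (\<integral>\<omega>'. \<integral>\<omega>. f (A \<omega>, B \<omega>') \<partial>M \<partial>M)"
    by (intro Bochner_Integration.integral_cong refl integral_distr)
      (auto intro!: measurable_compose[OF measurable_Pair1'] dest: measurable_space)
  finally show ?thesis .
qed

text \<open>With random mean \<open>r\<close> and weight \<open>w\<close>, the generating function of a mixture of Poisson laws is
  obtained by integrating the generating functions of the single laws.\<close>

lemma (in prob_space) mixed_poisson_pgf:
  assumes w [measurable]: "w \<in> borel_measurable M" and w01: "\<And>\<omega>. w \<omega> \<in> {0..1}"
    and r [measurable]: "r \<in> borel_measurable M" and r0: "\<And>\<omega>. 0 \<le> r \<omega>"
    and s: "0 \<le> s" "s \<le> 1"
  shows "(\<lambda>n. expectation (\<lambda>\<omega>. w \<omega> * pois (r \<omega>) n) * s ^ n)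
    sums expectation (\<lambda>\<omega>. w \<omega> * exp (- ((1 - s) * r \<omega>)))"
proof -
  have [measurable]: "(\<lambda>\<omega>. pois (r \<omega>) n) \<in> borel_measurable M" for n
    unfolding pois_def by measurable
  have int: "integrable M (\<lambda>\<omega>. w \<omega> * pois (r \<omega>) n)" for n
    using w01 r0 by (intro integrable_const_bound[where B=1] AE_I2)
      (auto simp: abs_mult pois_nonneg pois_le_1 intro!: mult_le_one)
  have "(\<lambda>k. expectation (\<lambda>\<omega>. w \<omega> * (\<Sum>n<k. pois (r \<omega>) n * s ^ n)))
      \<longlonglongrightarrow> expectation (\<lambda>\<omega>. w \<omega> * exp (- ((1 - s) * r \<omega>)))"
  proof (rule integral_dominated_convergence[where w="\<lambda>_. 1"])
    show "AE \<omega> in M. (\<lambda>k. w \<omega> * (\<Sum>n<k. pois (r \<omega>) n * s ^ n)) \<longlonglongrightarrow> w \<omega> * exp (- ((1 - s) * r \<omega>))"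
      using pois_pgf by (intro AE_I2 tendsto_intros) (simp add: sums_def)
    show "AE \<omega> in M. norm (w \<omega> * (\<Sum>n<k. pois (r \<omega>) n * s ^ n)) \<le> 1" for k
    proof (intro AE_I2)
      fix \<omega>
      have "(\<Sum>n<k. pois (r \<omega>) n * s ^ n) \<le> exp (- ((1 - s) * r \<omega>))"
        using pois_pgf[of "r \<omega>" s] s r0 by (subst sums_unique[OF pois_pgf])
          (intro sum_le_suminf, auto simp: sums_iff pois_nonneg)
      also have "\<dots> \<le> 1"
        using s r0 by simp
      finally show "norm (w \<omega> * (\<Sum>n<k. pois (r \<omega>) n * s ^ n)) \<le> 1"
        using w01[of \<omega>] s r0 by (auto simp: abs_mult pois_nonneg sum_nonneg intro!: mult_le_one)
    qed
  qed auto
  moreover have "expectation (\<lambda>\<omega>. w \<omega> * (\<Sum>n<k. pois (r \<omega>) n * s ^ n))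
      = (\<Sum>n<k. expectation (\<lambda>\<omega>. w \<omega> * pois (r \<omega>) n) * s ^ n)" for k
  proof -
    have "expectation (\<lambda>\<omega>. w \<omega> * (\<Sum>n<k. pois (r \<omega>) n * s ^ n))
        = expectation (\<lambda>\<omega>. \<Sum>n<k. s ^ n * (w \<omega> * pois (r \<omega>) n))"
      by (simp add: sum_distrib_left mult_ac)
    also have "\<dots> = (\<Sum>n<k. expectation (\<lambda>\<omega>. s ^ n * (w \<omega> * pois (r \<omega>) n)))"
      using int by (intro Bochner_Integration.integral_sum) simp
    also have "\<dots> = (\<Sum>n<k. expectation (\<lambda>\<omega>. w \<omega> * pois (r \<omega>) n) * s ^ n)"
      by (simp add: mult.commute)
    finally show ?thesis .
  qed
  ultimately show ?thesis
    by (simp add: sums_def)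
qed

section \<open>Polynomials in edge indicators\<close>

text \<open>Pairs \<open>(i, j)\<close> stand for the possible edge between vertex \<open>i\<close> and group \<open>j\<close>, vertex \<open>0\<close>
  being the origin. At edge indicators, \<open>nbh_weight L J\<close> is the indicator of the event that \<open>J\<close>
  is the set of groups in \<open>L\<close> joined to the origin. At edge probabilities it is the conditional
  probability of that event.\<close>

definition nbh_weight :: "nat set \<Rightarrow> nat set \<Rightarrow> (nat \<times> nat \<Rightarrow> real) \<Rightarrow> real" where
  "nbh_weight L J q = (\<Prod>j\<in>J. q (0, j)) * (\<Prod>j\<in>L - J. 1 - q (0, j))"

text \<open>At edge indicators this is \<open>s\<close> to the power of the number of vertices among \<open>1, ..., k\<close> that
  have an edge to a group in \<open>J\<close>.\<close>

definition conn_poly :: "real \<Rightarrow> nat \<Rightarrow> nat set \<Rightarrow> (nat \<times> nat \<Rightarrow> real) \<Rightarrow> real" where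
  "conn_poly s k J q = (\<Prod>i<k. s + (1 - s) * (\<Prod>j\<in>J. 1 - q (Suc i, j)))"

text \<open>The edges at the origin and those at the other vertices are distinct, so the polynomial is affine
  in every edge variable. The expansion into products over disjoint sets of present and of absent
  edges is what makes the conditional independence of edges applicable.\<close>

lemma nbh_conn_expansion:
  assumes L: "finite L" "J \<subseteq> L"
  shows "nbh_weight L J q * conn_poly s k J q =
    (\<Sum>I\<in>Pow {..<k}. s ^ card I * (1 - s) ^ card ({..<k} - I) *
       ((\<Prod>x\<in>{0} \<times> J. q x) * (\<Prod>x\<in>{0} \<times> (L - J) \<union> Suc ` ({..<k} - I) \<times> J. 1 - q x)))"
proof -
  have J: "finite J" using L finite_subset by blast
  have cartesian: "(\<Prod>x\<in>{0} \<times> A. h x) = (\<Prod>j\<in>A. h (0, j))" for A :: "nat set" and h :: "nat \<times> nat \<Rightarrow> real"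
    by (simp add: prod.cartesian_product')
  have "conn_poly s k J q = (\<Sum>I\<in>Pow {..<k}. s ^ card I *
      ((1 - s) ^ card ({..<k} - I) * (\<Prod>i\<in>{..<k} - I. \<Prod>j\<in>J. 1 - q (Suc i, j))))"
    unfolding conn_poly_def by (subst prod_add) (simp_all add: prod.distrib)
  moreover have "(\<Prod>x\<in>{0} \<times> (L - J) \<union> Suc ` I' \<times> J. 1 - q x)
      = (\<Prod>j\<in>L - J. 1 - q (0, j)) * (\<Prod>i\<in>I'. \<Prod>j\<in>J. 1 - q (Suc i, j))" if "finite I'" for I'
  proof -
    have "(\<Prod>x\<in>{0} \<times> (L - J) \<union> Suc ` I' \<times> J. 1 - q x)
        = (\<Prod>x\<in>{0} \<times> (L - J). 1 - q x) * (\<Prod>x\<in>Suc ` I' \<times> J. 1 - q x)"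
      using L J that by (intro prod.union_disjoint) auto
    also have "(\<Prod>x\<in>Suc ` I' \<times> J. 1 - q x) = (\<Prod>i\<in>I'. \<Prod>j\<in>J. 1 - q (Suc i, j))"
      by (simp add: prod.cartesian_product' prod.reindex)
    finally show ?thesis
      by (simp add: cartesian)
  qed
  ultimately show ?thesis
    by (simp add: nbh_weight_def cartesian sum_distrib_left mult_ac)
qed

lemma prod_nbh_expansion:
  assumes "finite L"
  shows "(\<Prod>j\<in>L. s + (1 - s) * (1 - q (0, j))) = (\<Sum>J\<in>Pow L. s ^ card J * nbh_weight L J q)"
proof -
  have "(\<Prod>j\<in>L. s + (1 - s) * (1 - q (0, j))) = (\<Prod>j\<in>L. s * q (0, j) + (1 - q (0, j)))"
    by (simp add: algebra_simps)
  also have "\<dots> = (\<Sum>J\<in>Pow L. s ^ card J * nbh_weight L J q)"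
    using assms by (subst prod_add) (auto simp: nbh_weight_def prod.distrib mult.assoc)
  finally show ?thesis .
qed

lemma nbh_weight_01:
  assumes "finite L" "J \<subseteq> L" "\<And>x. q x \<in> {0..1}"
  shows "nbh_weight L J q \<in> {0..1}"
  using assms by (auto simp: nbh_weight_def intro!: mult_nonneg_nonneg mult_le_one prod_nonneg prod_le_1)

lemma conn_poly_01:
  assumes "\<And>x. q x \<in> {0..1}" "0 \<le> s" "s \<le> 1"
  shows "conn_poly s k J q \<in> {0..1}"
proof -
  have "0 \<le> (\<Prod>j\<in>J. 1 - q (Suc i, j))" "(\<Prod>j\<in>J. 1 - q (Suc i, j)) \<le> 1" for i
    using assms by (auto intro!: prod_nonneg prod_le_1)
  moreover have "s + (1 - s) * x \<le> 1" if "x \<le> 1" for x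
    using mult_left_mono[OF that, of "1 - s"] assms by simp
  ultimately show ?thesis
    using assms by (auto simp: conn_poly_def intro!: prod_nonneg prod_le_1 add_nonneg_nonneg mult_nonneg_nonneg)
qed

lemma nbh_weight_indicator:
  assumes "finite L" "J \<subseteq> L" "\<And>x. q x = of_bool (P x)"
  shows "nbh_weight L J q = of_bool (J = {j\<in>L. P (0, j)})"
proof (cases "J = {j\<in>L. P (0, j)}")
  case True
  then show ?thesis
    using assms by (auto simp: nbh_weight_def)
next
  case False
  then obtain j where "j \<in> L" "j \<in> J \<and> \<not> P (0, j) \<or> j \<notin> J \<and> P (0, j)"
    using assms by auto
  then have "(\<Prod>j\<in>J. q (0, j)) = 0 \<or> (\<Prod>j\<in>L - J. 1 - q (0, j)) = 0"
    using assms finite_subset[OF assms(2)] by (auto intro!: bexI[of _ j])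
  with False show ?thesis
    by (auto simp: nbh_weight_def)
qed

section \<open>Conditional law of the degree given the groups\<close>

locale intersection_graph = random_bipartite_graph M lam mu g X Y E
  for M :: "'w measure" and lam mu :: real and g :: "'a::euclidean_space \<Rightarrow> real"
    and X Y :: "nat \<Rightarrow> 'w \<Rightarrow> 'a" and E :: "'w \<Rightarrow> ('a \<times> 'a) set" +
  assumes lam_pos: "lam > 0" and mu_pos: "mu > 0"
    and g01: "\<And>x. g x \<in> {0..1}"
    and g_even: "\<And>x. g (- x) = g x"
    and g_int: "integrable lborel g"
begin

abbreviation mass :: real where "mass \<equiv> LINT x|lborel. g x"

lemma g_nonneg: "0 \<le> g x" and g_le_1: "g x \<le> 1"
  using g01[of x] by auto

lemma g_measurable [measurable]: "g \<in> borel_measurable borel"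
  using g_int by simp

lemma mass_nonneg: "0 \<le> mass"
  by (simp add: integral_nonneg g_nonneg)

lemma X_measurable [measurable]: "X i \<in> borel_measurable M"
  and Y_measurable [measurable]: "Y i \<in> borel_measurable M"
  using poisson_process_measurable[OF vertex_process] poisson_process_measurable[OF group_process] by auto

lemma palm_measurable [measurable]: "palm X i \<in> borel_measurable M"
  by (cases i) (simp_all add: palm_def[abs_def])

definition edge :: "nat \<times> nat \<Rightarrow> 'w set" where
  "edge x = {\<omega> \<in> space M. (palm X (fst x) \<omega>, Y (snd x) \<omega>) \<in> E \<omega>}"

definition edge_prob :: "'w \<Rightarrow> nat \<times> nat \<Rightarrow> real" where
  "edge_prob \<omega> x = g (palm X (fst x) \<omega> - Y (snd x) \<omega>)"

abbreviation edge_ind :: "'w \<Rightarrow> nat \<times> nat \<Rightarrow> real" where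
  "edge_ind \<omega> x \<equiv> indicator (edge x) \<omega>"

lemma edge_sets [measurable]: "edge x \<in> events"
  unfolding edge_def by (rule edges_measurable)

lemma edge_prob_measurable [measurable]: "(\<lambda>\<omega>. edge_prob \<omega> x) \<in> borel_measurable M"
  unfolding edge_prob_def by measurable

lemma edge_prob_01: "edge_prob \<omega> x \<in> {0..1}"
  by (simp only: edge_prob_def g01)

lemma subalgebra_positions: "subalgebra M (positions M X Y)"
proof -
  have "(\<lambda>\<omega>. (\<lambda>i. X i \<omega>, \<lambda>j. Y j \<omega>))
      \<in> measurable M ((\<Pi>\<^sub>M i\<in>UNIV. borel) \<Otimes>\<^sub>M (\<Pi>\<^sub>M j\<in>UNIV. borel))"
    by (intro measurable_Pair measurable_PiM_single') auto
  then have "sets (positions M X Y) \<subseteq> sets M"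
    unfolding positions_def
    by (subst sets_vimage_algebra2) (auto dest: measurable_space intro: measurable_sets)
  then show ?thesis
    by (simp add: subalgebra_def positions_def)
qed

lemma expectation_edges:
  assumes S: "finite S"
  shows "expectation (\<lambda>\<omega>. \<Prod>x\<in>S. edge_ind \<omega> x) = expectation (\<lambda>\<omega>. \<Prod>x\<in>S. edge_prob \<omega> x)"
proof -
  interpret finite_measure_subalgebra M "positions M X Y"
    by unfold_locales (rule subalgebra_positions)
  define A where "A = {\<omega> \<in> space M. \<forall>(i, j)\<in>S. (palm X i \<omega>, Y j \<omega>) \<in> E \<omega>}"
  have ind: "indicat_real A \<omega> = (\<Prod>x\<in>S. edge_ind \<omega> x)" if \<omega>: "\<omega> \<in> space M" for \<omega>
  proof (cases "\<omega> \<in> A")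
    case True
    then have "\<forall>x\<in>S. \<omega> \<in> edge x"
      by (auto simp: A_def edge_def)
    with True show ?thesis
      by simp
  next
    case False
    then obtain x where "x \<in> S" "\<omega> \<notin> edge x"
      using \<omega> by (auto simp: A_def edge_def)
    with S False show ?thesis
      by (auto simp: indicator_def intro!: prod_zero[symmetric])
  qed
  have A: "integrable M (indicat_real A)"
  proof (subst Bochner_Integration.integrable_cong[OF refl ind])
    show "integrable M (\<lambda>\<omega>. \<Prod>x\<in>S. edge_ind \<omega> x)"
      by (intro integrable_const_bound[where B=1] AE_I2)
        (auto simp: abs_prod indicator_def intro!: prod_le_1)
  qed simp_all
  have "expectation (\<lambda>\<omega>. \<Prod>x\<in>S. edge_ind \<omega> x) = expectation (indicat_real A)"
    by (intro Bochner_Integration.integral_cong refl) (simp add: ind)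
  also have "\<dots> = expectation (real_cond_exp M (positions M X Y) (indicat_real A))"
    by (rule real_cond_exp_int(2)[OF A, symmetric])
  also have "\<dots> = expectation (\<lambda>\<omega>. \<Prod>x\<in>S. edge_prob \<omega> x)"
  proof (rule integral_cong_AE)
    show "AE \<omega> in M. real_cond_exp M (positions M X Y) (indicat_real A) \<omega> = (\<Prod>x\<in>S. edge_prob \<omega> x)"
      using edges_cond_indep[OF S] unfolding A_def edge_prob_def by (simp add: case_prod_beta')
  qed simp_all
  finally show ?thesis .
qed

text \<open>Given the positions, the edges are independent, so in the mean the indicators of edges may be
  replaced by their conditional probabilities.\<close>

lemma expectation_nbh_conn:
  assumes L: "finite L" "J \<subseteq> L"
  shows "expectation (\<lambda>\<omega>. nbh_weight L J (edge_ind \<omega>) * conn_poly s k J (edge_ind \<omega>))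
    = expectation (\<lambda>\<omega>. nbh_weight L J (edge_prob \<omega>) * conn_poly s k J (edge_prob \<omega>))"
proof -
  have J: "finite J" using L finite_subset by blast
  define S T where "S = {0::nat} \<times> J" and "T I = {0} \<times> (L - J) \<union> Suc ` ({..<k} - I) \<times> J" for I
  define C where "C I = s ^ card I * (1 - s) ^ card ({..<k} - I)" for I
  have exp: "expectation (\<lambda>\<omega>. nbh_weight L J (q \<omega>) * conn_poly s k J (q \<omega>))
      = (\<Sum>I\<in>Pow {..<k}. C I * expectation (\<lambda>\<omega>. (\<Prod>x\<in>S. q \<omega> x) * (\<Prod>x\<in>T I. 1 - q \<omega> x)))"
    if [measurable]: "\<And>x. (\<lambda>\<omega>. q \<omega> x) \<in> borel_measurable M" and q: "\<And>\<omega> x. q \<omega> x \<in> {0..1}"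
    for q :: "'w \<Rightarrow> nat \<times> nat \<Rightarrow> real"
  proof -
    have int: "integrable M (\<lambda>\<omega>. (\<Prod>x\<in>S. q \<omega> x) * (\<Prod>x\<in>T I. 1 - q \<omega> x))" for I
      using q by (intro integrable_const_bound[where B=1] AE_I2)
        (auto simp: abs_mult abs_prod intro!: mult_le_one prod_le_1 prod_nonneg)
    show ?thesis
      unfolding nbh_conn_expansion[OF L] S_def[symmetric] T_def[symmetric] C_def[symmetric]
      using int by (subst Bochner_Integration.integral_sum) auto
  qed
  have "expectation (\<lambda>\<omega>. (\<Prod>x\<in>S. edge_ind \<omega> x) * (\<Prod>x\<in>T I. 1 - edge_ind \<omega> x))
      = expectation (\<lambda>\<omega>. (\<Prod>x\<in>S. edge_prob \<omega> x) * (\<Prod>x\<in>T I. 1 - edge_prob \<omega> x))" for I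
    by (rule expectation_mixed_products)
      (use L J expectation_edges edge_prob_01 in \<open>auto simp: S_def T_def indicator_def\<close>)
  then show ?thesis
    using edge_prob_01 by (simp add: exp indicator_def)
qed

text \<open>The conditional probability that a vertex at \<open>x\<close> has an edge to one of the groups \<open>j \<in> J\<close>
  located at \<open>y j\<close>.\<close>

definition cover :: "nat set \<Rightarrow> (nat \<Rightarrow> 'a) \<Rightarrow> 'a \<Rightarrow> real" where
  "cover J y x = 1 - (\<Prod>j\<in>J. 1 - g (x - y j))"

definition cover_mass :: "nat set \<Rightarrow> 'w \<Rightarrow> real" where
  "cover_mass J \<omega> = (\<integral>x. cover J (\<lambda>j. Y j \<omega>) x \<partial>lborel)"

lemma cover_nonneg: "0 \<le> cover J y x" and cover_le_1: "cover J y x \<le> 1"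
  using g_nonneg g_le_1 by (auto simp: cover_def intro!: prod_le_1 prod_nonneg)

lemma shift_g: "integrable lborel (\<lambda>x. g (x - c))" "(\<integral>x. g (x - c) \<partial>lborel) = mass"
proof -
  have eq: "(+) (- c) = (\<lambda>x. x - c)"
    by (auto simp: fun_eq_iff)
  have "integrable (distr lborel borel ((+) (- c))) g"
    unfolding lborel_distr_plus by (rule g_int)
  then show "integrable lborel (\<lambda>x. g (x - c))"
    by (subst (asm) integrable_distr_eq) (simp_all add: eq)
  have "mass = (\<integral>x. g x \<partial>distr lborel borel ((+) (- c)))"
    unfolding lborel_distr_plus ..
  also have "\<dots> = (\<integral>x. g (x - c) \<partial>lborel)"
    by (subst integral_distr) (simp_all add: eq)
  finally show "(\<integral>x. g (x - c) \<partial>lborel) = mass" ..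
qed

lemma cover_le_sum:
  assumes "finite J"
  shows "cover J y x \<le> (\<Sum>j\<in>J. g (x - y j))"
proof -
  have "norm ((\<Prod>j\<in>J. 1) - (\<Prod>j\<in>J. 1 - g (x - y j))) \<le> (\<Sum>j\<in>J. norm (1 - (1 - g (x - y j))))"
    using g_nonneg g_le_1 by (intro norm_prod_diff) auto
  then show ?thesis
    using g_nonneg by (simp add: cover_def)
qed

lemma cover_measurable [measurable]: "cover J y \<in> borel_measurable borel"
  unfolding cover_def[abs_def] by measurable

lemma cover_int:
  assumes "finite J"
  shows "integrable lborel (cover J y)"
proof (rule Bochner_Integration.integrable_bound)
  show "integrable lborel (\<lambda>x. \<Sum>j\<in>J. g (x - y j))"
    by (intro Bochner_Integration.integrable_sum shift_g)
  show "AE x in lborel. norm (cover J y x) \<le> norm (\<Sum>j\<in>J. g (x - y j))"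
    using cover_le_sum[OF assms] cover_nonneg g_nonneg by (intro AE_I2) (simp add: sum_nonneg)
qed simp

lemma cover_mass_nonneg: "0 \<le> cover_mass J \<omega>"
  unfolding cover_mass_def by (simp add: integral_nonneg cover_nonneg)

text \<open>The union bound. A vertex that shares several groups with the origin is one neighbour, but it
  counts once for each of these groups in the compound Poisson variable. The bound is where this
  difference enters.\<close>

lemma cover_mass_le:
  assumes "finite J"
  shows "cover_mass J \<omega> \<le> real (card J) * mass"
proof -
  have "cover_mass J \<omega> \<le> (\<integral>x. (\<Sum>j\<in>J. g (x - Y j \<omega>)) \<partial>lborel)"
    unfolding cover_mass_def using assms cover_int cover_le_sum
    by (intro integral_mono Bochner_Integration.integrable_sum shift_g) auto
  also have "\<dots> = (\<Sum>j\<in>J. \<integral>x. g (x - Y j \<omega>) \<partial>lborel)"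
    by (intro Bochner_Integration.integral_sum shift_g)
  finally show ?thesis
    by (simp add: shift_g)
qed

lemma cover_mass_measurable [measurable]: "cover_mass J \<in> borel_measurable M"
  unfolding cover_mass_def[abs_def] cover_def
  by (rule lborel.borel_measurable_lebesgue_integral) measurable

definition nbh_prob :: "nat set \<Rightarrow> nat set \<Rightarrow> (nat \<Rightarrow> 'a) \<Rightarrow> real" where
  "nbh_prob L J y = (\<Prod>j\<in>J. g (0 - y j)) * (\<Prod>j\<in>L - J. 1 - g (0 - y j))"

lemma nbh_weight_edge_prob:
  "nbh_weight L J (edge_prob \<omega>) = nbh_prob L J (\<lambda>j. Y j \<omega>)"
  by (simp add: nbh_weight_def nbh_prob_def edge_prob_def palm_def)

lemma conn_poly_edge_prob:
  "conn_poly s k J (edge_prob \<omega>) = (\<Prod>i<k. 1 - (1 - s) * cover J (\<lambda>j. Y j \<omega>) (X i \<omega>))"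
  by (simp add: conn_poly_def cover_def edge_prob_def palm_def algebra_simps)

lemma nbh_weight_edge_prob_01:
  "finite L \<Longrightarrow> J \<subseteq> L \<Longrightarrow> nbh_weight L J (edge_prob \<omega>) \<in> {0..1}"
  by (rule nbh_weight_01) (simp_all only: edge_prob_01)

lemma nbh_weight_measurable [measurable]:
  "(\<lambda>\<omega>. nbh_weight L J (edge_prob \<omega>)) \<in> borel_measurable M"
  "(\<lambda>\<omega>. nbh_weight L J (edge_ind \<omega>)) \<in> borel_measurable M"
  unfolding nbh_weight_def by measurable

lemma conn_poly_measurable [measurable]:
  "(\<lambda>\<omega>. conn_poly s k J (edge_ind \<omega>)) \<in> borel_measurable M"
  unfolding conn_poly_def by measurable

text \<open>By independence of the two processes the groups can be held fixed while integrating over the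
  vertices. For fixed groups the vertices enter through the Laplace functional of their process at
  \<open>(1 - s) * cover J y\<close>, which gives the generating function of a Poisson law of mean
  \<open>lam * cover_mass J\<close>. This is the thinning theorem in the form needed here.\<close>

lemma expectation_conn_limit:
  assumes L: "finite L" "J \<subseteq> L" and s: "0 \<le> s" "s \<le> 1"
  shows "(\<lambda>k. expectation (\<lambda>\<omega>. nbh_weight L J (edge_ind \<omega>) * conn_poly s k J (edge_ind \<omega>)))
    \<longlonglongrightarrow> expectation (\<lambda>\<omega>. nbh_weight L J (edge_prob \<omega>) * exp (- ((1 - s) * (lam * cover_mass J \<omega>))))"
proof -
  have J: "finite J" using L finite_subset by blast
  define H where "H k = (\<lambda>(x, y). nbh_prob L J y * (\<Prod>i<k. 1 - (1 - s) * cover J y (x i)))"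
    for k :: nat
  let ?P = "\<Pi>\<^sub>M i\<in>(UNIV::nat set). (borel :: 'a measure)"
  have [measurable]: "(\<lambda>z. fst z i) \<in> borel_measurable (?P \<Otimes>\<^sub>M ?P)" "(\<lambda>z. snd z i) \<in> borel_measurable (?P \<Otimes>\<^sub>M ?P)" for i
    by (auto intro: measurable_compose[OF measurable_fst measurable_component_singleton]
        measurable_compose[OF measurable_snd measurable_component_singleton])
  have H_meas: "H k \<in> borel_measurable (?P \<Otimes>\<^sub>M ?P)" for k
    unfolding H_def nbh_prob_def cover_def case_prod_beta' by measurable
  have damp: "0 \<le> 1 - (1 - s) * cover J y x" "1 - (1 - s) * cover J y x \<le> 1" for y x
    using s cover_nonneg[of J y x] cover_le_1[of J y x] mult_le_one[of "1 - s" "cover J y x"] by auto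
  have prod01: "0 \<le> (\<Prod>i<k. 1 - (1 - s) * cover J y (x i))" "(\<Prod>i<k. 1 - (1 - s) * cover J y (x i)) \<le> 1" for k :: nat and y x
    using damp by (auto intro!: prod_nonneg prod_le_1)
  have nbh01: "0 \<le> nbh_prob L J y" "nbh_prob L J y \<le> 1" for y
    using g_nonneg g_le_1 by (auto simp: nbh_prob_def intro!: mult_nonneg_nonneg mult_le_one prod_nonneg prod_le_1)
  have H_bnd: "\<bar>H k z\<bar> \<le> 1" for k z
    using prod01 nbh01 by (auto simp: H_def abs_mult abs_of_nonneg intro!: mult_le_one split: prod.split)
  have eq: "expectation (\<lambda>\<omega>. nbh_weight L J (edge_ind \<omega>) * conn_poly s k J (edge_ind \<omega>))
      = (\<integral>\<omega>'. nbh_weight L J (edge_prob \<omega>') *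
          (\<integral>\<omega>. (\<Prod>i<k. 1 - (1 - s) * cover J (\<lambda>j. Y j \<omega>') (X i \<omega>)) \<partial>M) \<partial>M)" for k
  proof -
    have "expectation (\<lambda>\<omega>. nbh_weight L J (edge_ind \<omega>) * conn_poly s k J (edge_ind \<omega>))
        = expectation (\<lambda>\<omega>. H k (\<lambda>i. X i \<omega>, \<lambda>j. Y j \<omega>))"
      unfolding expectation_nbh_conn[OF L] by (simp add: H_def nbh_weight_edge_prob conn_poly_edge_prob)
    also have "\<dots> = (\<integral>\<omega>'. \<integral>\<omega>. H k (\<lambda>i. X i \<omega>, \<lambda>j. Y j \<omega>') \<partial>M \<partial>M)"
      by (rule expectation_indep_var[OF processes_indep H_meas H_bnd])
    finally show ?thesis
      by (simp add: H_def nbh_weight_edge_prob)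
  qed
  have inner_meas: "(\<lambda>\<omega>'. \<integral>\<omega>. (\<Prod>i<k. 1 - (1 - s) * cover J (\<lambda>j. Y j \<omega>') (X i \<omega>)) \<partial>M) \<in> borel_measurable M" for k
    unfolding cover_def by (rule borel_measurable_lebesgue_integral) measurable
  show ?thesis
    unfolding eq
  proof (rule integral_dominated_convergence[where w="\<lambda>_. 1"])
    show "AE \<omega>' in M. (\<lambda>k. nbh_weight L J (edge_prob \<omega>') *
          (\<integral>\<omega>. (\<Prod>i<k. 1 - (1 - s) * cover J (\<lambda>j. Y j \<omega>') (X i \<omega>)) \<partial>M))
        \<longlonglongrightarrow> nbh_weight L J (edge_prob \<omega>') * exp (- ((1 - s) * (lam * cover_mass J \<omega>')))"
    proof (intro AE_I2 tendsto_mult tendsto_const)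
      fix \<omega>'
      have "(\<lambda>k. \<integral>\<omega>. (\<Prod>i<k. 1 - (1 - s) * cover J (\<lambda>j. Y j \<omega>') (X i \<omega>)) \<partial>M)
        \<longlonglongrightarrow> exp (- (lam * (\<integral>x. (1 - s) * cover J (\<lambda>j. Y j \<omega>') x \<partial>lborel)))"
        using s damp cover_nonneg
        by (intro laplace_functional[OF prob_space_axioms vertex_process lam_pos])
          (auto intro!: cover_int J mult_le_one cover_le_1)
      then show "(\<lambda>k. \<integral>\<omega>. (\<Prod>i<k. 1 - (1 - s) * cover J (\<lambda>j. Y j \<omega>') (X i \<omega>)) \<partial>M)
        \<longlonglongrightarrow> exp (- ((1 - s) * (lam * cover_mass J \<omega>')))"
        by (simp add: cover_mass_def mult_ac)
    qed
    show "AE \<omega>' in M. norm (nbh_weight L J (edge_prob \<omega>') *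
          (\<integral>\<omega>. (\<Prod>i<k. 1 - (1 - s) * cover J (\<lambda>j. Y j \<omega>') (X i \<omega>)) \<partial>M)) \<le> 1" for k
    proof (intro AE_I2)
      fix \<omega>'
      have "(\<integral>\<omega>. (\<Prod>i<k. 1 - (1 - s) * cover J (\<lambda>j. Y j \<omega>') (X i \<omega>)) \<partial>M) \<le> 1"
        using prod01
        by (intro integral_le_const integrable_const_bound[where B=1] AE_I2) (auto simp: abs_of_nonneg)
      moreover have "0 \<le> (\<integral>\<omega>. (\<Prod>i<k. 1 - (1 - s) * cover J (\<lambda>j. Y j \<omega>') (X i \<omega>)) \<partial>M)"
        using prod01 by (intro Bochner_Integration.integral_nonneg) auto
      ultimately show "norm (nbh_weight L J (edge_prob \<omega>') *
          (\<integral>\<omega>. (\<Prod>i<k. 1 - (1 - s) * cover J (\<lambda>j. Y j \<omega>') (X i \<omega>)) \<partial>M)) \<le> 1"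
        using nbh01 by (auto simp: abs_mult nbh_weight_edge_prob intro!: mult_le_one)
    qed
    show "(\<lambda>\<omega>'. nbh_weight L J (edge_prob \<omega>') *
          (\<integral>\<omega>. (\<Prod>i<k. 1 - (1 - s) * cover J (\<lambda>j. Y j \<omega>') (X i \<omega>)) \<partial>M)) \<in> borel_measurable M" for k
      using inner_meas by measurable
  qed auto
qed

lemma expectation_nbh:
  assumes L: "finite L" "J \<subseteq> L"
  shows "expectation (\<lambda>\<omega>. nbh_weight L J (edge_ind \<omega>)) = expectation (\<lambda>\<omega>. nbh_weight L J (edge_prob \<omega>))"
  using expectation_nbh_conn[OF L, where k=0 and s=0] by (simp add: conn_poly_def)

text \<open>The event that the origin and the point \<open>X i\<close> share one of the first \<open>l\<close> groups. Restricting to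
  finitely many groups keeps the possible sets of groups of the origin finite in number. The
  point \<open>X i\<close> is vertex \<open>Suc i\<close>.\<close>

definition conn :: "nat \<Rightarrow> nat \<Rightarrow> 'w set" where
  "conn l i = (\<Union>j<l. edge (0, j) \<inter> edge (Suc i, j))"

lemma conn_sets [measurable]: "conn l i \<in> events"
  unfolding conn_def by measurable

lemma nbh_weight_edge_ind:
  assumes "J \<subseteq> {..<l}"
  shows "nbh_weight {..<l} J (edge_ind \<omega>) = of_bool (J = {j\<in>{..<l}. \<omega> \<in> edge (0, j)})"
  by (rule nbh_weight_indicator) (use assms in \<open>auto simp: indicator_def\<close>)

lemma sum_nbh_weight:
  "(\<Sum>J\<in>Pow {..<l}. nbh_weight {..<l} J (edge_ind \<omega>) * f J) = f {j\<in>{..<l}. \<omega> \<in> edge (0, j)}"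
proof -
  have "(\<Sum>J\<in>Pow {..<l}. nbh_weight {..<l} J (edge_ind \<omega>) * f J)
      = (\<Sum>J\<in>Pow {..<l}. if J = {j\<in>{..<l}. \<omega> \<in> edge (0, j)} then f J else 0)"
    by (intro sum.cong) (auto simp: nbh_weight_edge_ind)
  also have "\<dots> = f {j\<in>{..<l}. \<omega> \<in> edge (0, j)}"
    by (subst sum.delta) auto
  finally show ?thesis .
qed

lemma integrable_nbh_weight:
  "integrable M (\<lambda>\<omega>. nbh_weight {..<l} J (edge_ind \<omega>))"
  if "J \<subseteq> {..<l}"
  by (intro integrable_const_bound[where B=1] AE_I2 nbh_weight_measurable)
    (simp add: nbh_weight_edge_ind that)

text \<open>A mixture of Poisson laws: \<open>J\<close> runs over the possible sets of groups joined to the origin, and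
  given the groups and \<open>J\<close> the number of points sharing a group in \<open>J\<close> with the origin is
  Poisson distributed with mean \<open>lam * cover_mass J\<close>.\<close>

lemma count_conn_law:
  "prob {\<omega> \<in> space M. ecard {i. \<omega> \<in> conn l i} = enat n}
    = (\<Sum>J\<in>Pow {..<l}. expectation (\<lambda>\<omega>. nbh_weight {..<l} J (edge_prob \<omega>) * pois (lam * cover_mass J \<omega>) n))"
proof (rule count_law)
  fix s :: real assume s: "0 \<le> s" "s < 1"
  let ?G = "\<lambda>J. expectation (\<lambda>\<omega>. nbh_weight {..<l} J (edge_prob \<omega>) * exp (- ((1 - s) * (lam * cover_mass J \<omega>))))"
  have "(\<lambda>n. expectation (\<lambda>\<omega>. nbh_weight {..<l} J (edge_prob \<omega>) * pois (lam * cover_mass J \<omega>) n) * s ^ n)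
      sums ?G J" if "J \<in> Pow {..<l}" for J
    using that s lam_pos cover_mass_nonneg
    by (intro mixed_poisson_pgf nbh_weight_edge_prob_01) simp_all
  then show "(\<lambda>n. (\<Sum>J\<in>Pow {..<l}. expectation (\<lambda>\<omega>. nbh_weight {..<l} J (edge_prob \<omega>) * pois (lam * cover_mass J \<omega>) n)) * s ^ n)
      sums (\<Sum>J\<in>Pow {..<l}. ?G J)"
    unfolding sum_distrib_right by (rule sums_sum)
  \<comment> \<open>Only the summand of the actual set of groups joined to the origin is nonzero.\<close>
  have eq: "(\<Prod>i<k. s + (1 - s) * (1 - indicator (conn l i) \<omega>))
      = (\<Sum>J\<in>Pow {..<l}. nbh_weight {..<l} J (edge_ind \<omega>) * conn_poly s k J (edge_ind \<omega>))" for k \<omega>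
  proof -
    have "1 - indicat_real (conn l i) \<omega> = (\<Prod>j | j \<in> {..<l} \<and> \<omega> \<in> edge (0, j). 1 - edge_ind \<omega> (Suc i, j))" for i
    proof (cases "\<omega> \<in> conn l i")
      case True
      then show ?thesis
        by (auto simp: conn_def intro!: prod_zero[symmetric])
    next
      case False
      then have "\<omega> \<notin> edge (Suc i, j)" if "j < l" "\<omega> \<in> edge (0, j)" for j
        using that by (auto simp: conn_def)
      with False show ?thesis
        by simp
    qed
    then show ?thesis
      unfolding sum_nbh_weight conn_poly_def by simp
  qed
  have int: "integrable M (\<lambda>\<omega>. nbh_weight {..<l} J (edge_ind \<omega>) * conn_poly s k J (edge_ind \<omega>))"
    if "J \<in> Pow {..<l}" for J k
  proof (intro integrable_const_bound[where B=1] AE_I2 borel_measurable_times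
      nbh_weight_measurable conn_poly_measurable)
    fix \<omega>
    have "nbh_weight {..<l} J (edge_ind \<omega>) \<in> {0..1}"
      using that by (intro nbh_weight_01) (auto simp: indicator_def)
    moreover have "conn_poly s k J (edge_ind \<omega>) \<in> {0..1}"
      using s by (intro conn_poly_01) (auto simp: indicator_def)
    ultimately show "norm (nbh_weight {..<l} J (edge_ind \<omega>) * conn_poly s k J (edge_ind \<omega>)) \<le> 1"
      by (simp add: abs_mult mult_le_one)
  qed
  have "(\<lambda>k. \<Sum>J\<in>Pow {..<l}. expectation (\<lambda>\<omega>. nbh_weight {..<l} J (edge_ind \<omega>) * conn_poly s k J (edge_ind \<omega>)))
      \<longlonglongrightarrow> (\<Sum>J\<in>Pow {..<l}. ?G J)"
    using s by (intro tendsto_sum expectation_conn_limit) auto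
  then show "(\<lambda>k. expectation (\<lambda>\<omega>. \<Prod>i<k. s + (1 - s) * (1 - indicator (conn l i) \<omega>)))
      \<longlonglongrightarrow> (\<Sum>J\<in>Pow {..<l}. ?G J)"
    unfolding eq using int by (simp add: Bochner_Integration.integral_sum)
qed simp

text \<open>The groups joined to the origin are a thinning of the group process with retention probability
  \<open>g (0 - y)\<close>, which equals \<open>g y\<close>.\<close>

lemma count_groups_law:
  "prob {\<omega> \<in> space M. ecard {j. \<omega> \<in> edge (0, j)} = enat n} = pois (mu * mass) n"
proof (rule count_law)
  fix s :: real assume s: "0 \<le> s" "s < 1"
  show "(\<lambda>n. pois (mu * mass) n * s ^ n) sums exp (- ((1 - s) * (mu * mass)))"
    by (rule pois_pgf)
  have int: "integrable M (\<lambda>\<omega>. nbh_weight {..<k} J (edge_prob \<omega>))" if "J \<in> Pow {..<k}" for J k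
    using that nbh_weight_edge_prob_01[of "{..<k}" J]
    by (intro integrable_const_bound[where B=1] AE_I2) auto
  have "expectation (\<lambda>\<omega>. \<Prod>j<k. s + (1 - s) * (1 - edge_ind \<omega> (0, j)))
      = expectation (\<lambda>\<omega>. \<Prod>j<k. 1 - (1 - s) * g (Y j \<omega>))" for k
  proof -
    have "expectation (\<lambda>\<omega>. \<Prod>j<k. s + (1 - s) * (1 - edge_ind \<omega> (0, j)))
        = (\<Sum>J\<in>Pow {..<k}. s ^ card J * expectation (\<lambda>\<omega>. nbh_weight {..<k} J (edge_ind \<omega>)))"
      unfolding prod_nbh_expansion[OF finite_lessThan, where q="edge_ind _"]
      by (subst Bochner_Integration.integral_sum) (auto intro!: integrable_nbh_weight)
    also have "\<dots> = (\<Sum>J\<in>Pow {..<k}. s ^ card J * expectation (\<lambda>\<omega>. nbh_weight {..<k} J (edge_prob \<omega>)))"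
      by (intro sum.cong refl) (simp add: expectation_nbh)
    also have "\<dots> = expectation (\<lambda>\<omega>. \<Prod>j<k. s + (1 - s) * (1 - edge_prob \<omega> (0, j)))"
      unfolding prod_nbh_expansion[OF finite_lessThan, where q="edge_prob _"] using int
      by (subst Bochner_Integration.integral_sum) auto
    also have "\<dots> = expectation (\<lambda>\<omega>. \<Prod>j<k. 1 - (1 - s) * g (Y j \<omega>))"
      by (simp add: edge_prob_def palm_def g_even algebra_simps)
    finally show ?thesis .
  qed
  moreover have "(\<lambda>k. expectation (\<lambda>\<omega>. \<Prod>j<k. 1 - (1 - s) * g (Y j \<omega>)))
      \<longlonglongrightarrow> exp (- (mu * (\<integral>x. (1 - s) * g x \<partial>lborel)))"
    using s g_nonneg g_le_1 g_int
    by (intro laplace_functional[OF prob_space_axioms group_process mu_pos]) (auto intro!: mult_le_one)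
  ultimately show "(\<lambda>k. expectation (\<lambda>\<omega>. \<Prod>j<k. s + (1 - s) * (1 - edge_ind \<omega> (0, j))))
      \<longlonglongrightarrow> exp (- ((1 - s) * (mu * mass)))"
    by (simp add: mult_ac)
qed simp

section \<open>The bound on the distribution function of the degree\<close>

text \<open>Given that \<open>J\<close> is the set of groups joined to the origin, the mean of the Poisson law is at most
  \<open>card J * (lam * mass)\<close> and the distribution function at \<open>m\<close> is at least \<open>\<phi> (card J)\<close>, where
  \<open>\<phi> n\<close> belongs to the mean \<open>n * (lam * mass)\<close> and decreases in \<open>n\<close>. Averaging gives the
  mean of \<open>\<phi>\<close> at the number of these groups. Passing from the first \<open>l\<close> groups to all of
  them, whose number is Poisson distributed with mean \<open>mu * mass\<close>, only decreases it. The bound is by finite sums in order not to involve an infinite number of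
  groups.\<close>

lemma count_conn_cdf_ge:
  "(\<Sum>n<n0. pois (mu * mass) n * pois_cdf (real n * (lam * mass)) m)
    \<le> prob {\<omega> \<in> space M. ecard {i. \<omega> \<in> conn l i} \<le> enat m}"
proof -
  define \<phi> where "\<phi> n = pois_cdf (real n * (lam * mass)) m" for n
  have rate_nonneg: "0 \<le> lam * mass"
    using lam_pos mass_nonneg by simp
  have \<phi>_nonneg: "0 \<le> \<phi> n" for n
    unfolding \<phi>_def using rate_nonneg by (intro pois_cdf_nonneg) simp
  have \<phi>_antimono: "\<phi> b \<le> \<phi> a" if "a \<le> b" for a b
    unfolding \<phi>_def using rate_nonneg that by (intro pois_cdf_antimono mult_right_mono) simp_all
  define N where "N n = {\<omega> \<in> space M. ecard {j. \<omega> \<in> edge (0, j)} = enat n}" for n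
  have [measurable]: "N n \<in> events" for n
    unfolding N_def by (rule ecard_event) simp
  have int_N: "integrable M (indicat_real (N n))" for n
    by (intro integrable_real_indicator) (simp_all add: less_top[symmetric])
  have int_pois: "integrable M (\<lambda>\<omega>. nbh_weight {..<l} J (edge_prob \<omega>) * pois (lam * cover_mass J \<omega>) n)"
    if J: "J \<in> Pow {..<l}" for J n
  proof (intro integrable_const_bound[where B=1] AE_I2)
    show "norm (nbh_weight {..<l} J (edge_prob \<omega>) * pois (lam * cover_mass J \<omega>) n) \<le> 1" for \<omega>
      using nbh_weight_edge_prob_01[of "{..<l}" J \<omega>] J lam_pos cover_mass_nonneg
      by (auto simp: abs_mult pois_nonneg pois_le_1 intro!: mult_le_one)
    show "(\<lambda>\<omega>. nbh_weight {..<l} J (edge_prob \<omega>) * pois (lam * cover_mass J \<omega>) n) \<in> borel_measurable M"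
      unfolding pois_def by measurable
  qed
  have "(\<Sum>n<n0. pois (mu * mass) n * \<phi> n) = (\<Sum>n<n0. prob (N n) * \<phi> n)"
    by (simp add: N_def count_groups_law)
  also have "\<dots> = expectation (\<lambda>\<omega>. \<Sum>n<n0. indicator (N n) \<omega> * \<phi> n)"
    by (subst Bochner_Integration.integral_sum) (simp_all add: int_N)
  also have "\<dots> \<le> expectation (\<lambda>\<omega>. \<Sum>J\<in>Pow {..<l}. nbh_weight {..<l} J (edge_ind \<omega>) * \<phi> (card J))"
  proof (rule integral_mono)
    show "integrable M (\<lambda>\<omega>. \<Sum>n<n0. indicator (N n) \<omega> * \<phi> n)"
      by (intro Bochner_Integration.integrable_sum integrable_mult_left int_N)
    show "integrable M (\<lambda>\<omega>. \<Sum>J\<in>Pow {..<l}. nbh_weight {..<l} J (edge_ind \<omega>) * \<phi> (card J))"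
      by (intro Bochner_Integration.integrable_sum integrable_mult_left integrable_nbh_weight) auto
    fix \<omega> assume \<omega>: "\<omega> \<in> space M"
    show "(\<Sum>n<n0. indicator (N n) \<omega> * \<phi> n)
        \<le> (\<Sum>J\<in>Pow {..<l}. nbh_weight {..<l} J (edge_ind \<omega>) * \<phi> (card J))"
      unfolding sum_nbh_weight
    proof (cases "\<exists>n<n0. \<omega> \<in> N n")
      case True
      then obtain n where n: "n < n0" "\<omega> \<in> N n" by blast
      then have fin: "finite {j. \<omega> \<in> edge (0, j)}" and card: "card {j. \<omega> \<in> edge (0, j)} = n"
        by (auto simp: N_def ecard_def split: if_splits)
      have "(\<Sum>k<n0. indicator (N k) \<omega> * \<phi> k) = (\<Sum>k<n0. if k = n then \<phi> k else 0)"
        using n by (intro sum.cong) (auto simp: N_def indicator_def)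
      also have "\<dots> = \<phi> n"
        using n by simp
      also have "\<dots> \<le> \<phi> (card {j \<in> {..<l}. \<omega> \<in> edge (0, j)})"
        unfolding card[symmetric] by (intro \<phi>_antimono card_mono fin) auto
      finally show "(\<Sum>n<n0. indicator (N n) \<omega> * \<phi> n) \<le> \<phi> (card {j \<in> {..<l}. \<omega> \<in> edge (0, j)})" .
    next
      case False
      then show "(\<Sum>n<n0. indicator (N n) \<omega> * \<phi> n) \<le> \<phi> (card {j \<in> {..<l}. \<omega> \<in> edge (0, j)})"
        using \<phi>_nonneg by (subst sum.neutral) auto
    qed
  qed
  also have "\<dots> = (\<Sum>J\<in>Pow {..<l}. expectation (\<lambda>\<omega>. nbh_weight {..<l} J (edge_prob \<omega>)) * \<phi> (card J))"
    by (subst Bochner_Integration.integral_sum)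
      (auto intro!: integrable_mult_left integrable_nbh_weight sum.cong simp: expectation_nbh)
  also have "\<dots> \<le> (\<Sum>J\<in>Pow {..<l}. \<Sum>n\<le>m. expectation (\<lambda>\<omega>. nbh_weight {..<l} J (edge_prob \<omega>) * pois (lam * cover_mass J \<omega>) n))"
  proof (rule sum_mono)
    fix J assume J: "J \<in> Pow {..<l}"
    then have fin: "finite J"
      using finite_subset by auto
    have "expectation (\<lambda>\<omega>. nbh_weight {..<l} J (edge_prob \<omega>)) * \<phi> (card J)
        = expectation (\<lambda>\<omega>. nbh_weight {..<l} J (edge_prob \<omega>) * \<phi> (card J))"
      by simp
    also have "\<dots> \<le> expectation (\<lambda>\<omega>. \<Sum>n\<le>m. nbh_weight {..<l} J (edge_prob \<omega>) * pois (lam * cover_mass J \<omega>) n)"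
    proof (rule integral_mono)
      have w: "nbh_weight {..<l} J (edge_prob \<omega>) \<in> {0..1}" for \<omega>
        using J by (intro nbh_weight_edge_prob_01) auto
      then show "integrable M (\<lambda>\<omega>. nbh_weight {..<l} J (edge_prob \<omega>) * \<phi> (card J))"
        by (intro integrable_mult_left integrable_const_bound[where B=1] AE_I2) auto
      show "integrable M (\<lambda>\<omega>. \<Sum>n\<le>m. nbh_weight {..<l} J (edge_prob \<omega>) * pois (lam * cover_mass J \<omega>) n)"
        by (intro Bochner_Integration.integrable_sum int_pois J)
      fix \<omega>
      have "lam * cover_mass J \<omega> \<le> real (card J) * (lam * mass)"
        using mult_left_mono[OF cover_mass_le[OF fin, of \<omega>], of lam] lam_pos by (simp add: mult_ac)
      then have "\<phi> (card J) \<le> pois_cdf (lam * cover_mass J \<omega>) m"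
        unfolding \<phi>_def using lam_pos cover_mass_nonneg by (intro pois_cdf_antimono) auto
      then show "nbh_weight {..<l} J (edge_prob \<omega>) * \<phi> (card J)
          \<le> (\<Sum>n\<le>m. nbh_weight {..<l} J (edge_prob \<omega>) * pois (lam * cover_mass J \<omega>) n)"
        using w[of \<omega>] by (simp add: pois_cdf_def sum_distrib_left[symmetric] mult_left_mono)
    qed
    also have "\<dots> = (\<Sum>n\<le>m. expectation (\<lambda>\<omega>. nbh_weight {..<l} J (edge_prob \<omega>) * pois (lam * cover_mass J \<omega>) n))"
      by (intro Bochner_Integration.integral_sum int_pois J)
    finally show "expectation (\<lambda>\<omega>. nbh_weight {..<l} J (edge_prob \<omega>)) * \<phi> (card J)
      \<le> (\<Sum>n\<le>m. expectation (\<lambda>\<omega>. nbh_weight {..<l} J (edge_prob \<omega>) * pois (lam * cover_mass J \<omega>) n))" .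
  qed
  also have "\<dots> = (\<Sum>n\<le>m. prob {\<omega> \<in> space M. ecard {i. \<omega> \<in> conn l i} = enat n})"
    unfolding count_conn_law by (rule sum.swap)
  also have "\<dots> = prob {\<omega> \<in> space M. ecard {i. \<omega> \<in> conn l i} \<le> enat m}"
    by (rule prob_ecard_le[symmetric]) simp
  finally show ?thesis
    unfolding \<phi>_def .
qed

definition conn_any :: "nat \<Rightarrow> 'w set" where
  "conn_any i = (\<Union>l. conn l i)"

lemma conn_any_sets [measurable]: "conn_any i \<in> events"
  unfolding conn_any_def by measurable

lemma incseq_conn: "l \<le> l' \<Longrightarrow> conn l i \<subseteq> conn l' i"
  unfolding conn_def by (intro UN_mono) auto

text \<open>The lower bound does not depend on \<open>l\<close>, so it passes to the limit.\<close>

lemma count_conn_any_cdf_ge: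
  "(\<Sum>n<n0. pois (mu * mass) n * pois_cdf (real n * (lam * mass)) m)
    \<le> prob {\<omega> \<in> space M. ecard {i. \<omega> \<in> conn_any i} \<le> enat m}"
proof -
  define D where "D l = {\<omega> \<in> space M. ecard {i. \<omega> \<in> conn l i} \<le> enat m}" for l
  have D: "D l \<in> events" for l
  proof -
    have "D l = (\<Union>n\<in>{..m}. {\<omega> \<in> space M. ecard {i. \<omega> \<in> conn l i} = enat n})"
      by (auto simp: D_def ecard_le_iff)
    also have "\<dots> \<in> events"
      by (intro sets.finite_UN ecard_event) auto
    finally show ?thesis .
  qed
  have inc: "incseq (\<lambda>l. {i. \<omega> \<in> conn l i})" for \<omega>
    using incseq_conn by (auto simp: incseq_def)
  have "ecard {i. \<omega> \<in> conn l i} \<le> ecard {i. \<omega> \<in> conn l' i}" if "l \<le> l'" for l l' \<omega>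
    by (rule ecard_le_mono) (use incseq_conn[OF that] in blast)
  then have "decseq D"
    unfolding decseq_def D_def by (auto intro: order_trans)
  then have "(\<lambda>l. prob (D l)) \<longlonglongrightarrow> prob (\<Inter>l. D l)"
    using D by (intro finite_Lim_measure_decseq) auto
  moreover have "(\<Inter>l. D l) = {\<omega> \<in> space M. ecard {i. \<omega> \<in> conn_any i} \<le> enat m}"
  proof -
    have "{i. \<omega> \<in> conn_any i} = (\<Union>l. {i. \<omega> \<in> conn l i})" for \<omega>
      by (auto simp: conn_any_def)
    then show ?thesis
      by (auto simp: D_def ecard_Union_le_iff[OF inc])
  qed
  ultimately show ?thesis
    using count_conn_cdf_ge[where ?n0.0=n0 and m=m] unfolding D_def
    by (intro LIMSEQ_le_const) auto
qed

text \<open>The degree counts positions, not indices. Almost surely these agree, but measurability of the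
  degree concerns every outcome, including those where positions repeat or coincide with the
  origin. Counting each neighbour at the first index of its position represents the degree on the
  whole space.\<close>

definition fresh_conn :: "nat \<Rightarrow> 'w set" where
  "fresh_conn i = {\<omega> \<in> conn_any i. X i \<omega> \<noteq> 0 \<and> (\<forall>k<i. X k \<omega> \<noteq> X i \<omega>)}"

lemma fresh_conn_sets [measurable]: "fresh_conn i \<in> events"
proof -
  have "fresh_conn i = {\<omega> \<in> space M. \<omega> \<in> conn_any i \<and> X i \<omega> \<noteq> 0 \<and> (\<forall>k<i. X k \<omega> \<noteq> X i \<omega>)}"
    using sets.sets_into_space[OF conn_any_sets] by (auto simp: fresh_conn_def)
  also have "\<dots> \<in> events"
    by measurable
  finally show ?thesis .
qed

lemma conn_any_iff:
  "\<omega> \<in> space M \<Longrightarrow> \<omega> \<in> conn_any i \<longleftrightarrow> (\<exists>j. (0, Y j \<omega>) \<in> E \<omega> \<and> (X i \<omega>, Y j \<omega>) \<in> E \<omega>)"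
  by (auto simp: conn_any_def conn_def edge_def palm_def)

lemma origin_degree_eq:
  assumes \<omega>: "\<omega> \<in> space M"
  shows "origin_degree X Y E \<omega> = ecard {i. \<omega> \<in> fresh_conn i}"
proof -
  have "{v \<in> points (palm X) \<omega> - {0}. intersection_adj (points (palm X) \<omega>) (points Y \<omega>) (E \<omega>) 0 v}
      = (\<lambda>i. X i \<omega>) ` {i. \<omega> \<in> fresh_conn i}" (is "?N = ?R")
  proof (intro equalityI subsetI)
    fix v assume v: "v \<in> ?N"
    then obtain i' where "v = palm X i' \<omega>" "v \<noteq> 0"
      by (auto simp: points_def)
    then obtain i where "X i \<omega> = v"
      by (cases i') (auto simp: palm_def)
    define i0 where "i0 = (LEAST i. X i \<omega> = v)"
    have i0: "X i0 \<omega> = v"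
      unfolding i0_def by (rule LeastI) fact
    have "X k \<omega> \<noteq> v" if "k < i0" for k
      using that not_less_Least unfolding i0_def by blast
    moreover have "\<omega> \<in> conn_any i0"
      using v i0 by (auto simp: conn_any_iff[OF \<omega>] intersection_adj_def points_def)
    ultimately show "v \<in> ?R"
      using i0 \<open>v \<noteq> 0\<close> by (auto simp: fresh_conn_def intro!: image_eqI[of _ _ i0])
  next
    fix v assume "v \<in> ?R"
    then obtain i where i: "\<omega> \<in> fresh_conn i" "v = X i \<omega>"
      by blast
    then obtain j where j: "(0, Y j \<omega>) \<in> E \<omega>" "(X i \<omega>, Y j \<omega>) \<in> E \<omega>" and v: "v \<noteq> 0"
      by (auto simp: fresh_conn_def conn_any_iff[OF \<omega>])
    have "0 \<in> points (palm X) \<omega>" "v \<in> points (palm X) \<omega>" "Y j \<omega> \<in> points Y \<omega>"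
      using edges_bipartite[OF \<omega>] j i by auto
    with i j v show "v \<in> ?N"
      by (auto simp: intersection_adj_def)
  qed
  moreover have "inj_on (\<lambda>i. X i \<omega>) {i. \<omega> \<in> fresh_conn i}"
  proof (rule linorder_inj_onI')
    fix i k assume "i \<in> {i. \<omega> \<in> fresh_conn i}" "k \<in> {i. \<omega> \<in> fresh_conn i}" "i < k"
    then show "X i \<omega> \<noteq> X k \<omega>"
      by (auto simp: fresh_conn_def)
  qed
  ultimately show ?thesis
    by (simp add: origin_degree_def ecard_def card_image finite_image_iff)
qed

lemma origin_degree_event: "{\<omega> \<in> space M. origin_degree X Y E \<omega> = enat n} \<in> events"
proof -
  have "{\<omega> \<in> space M. origin_degree X Y E \<omega> = enat n}
      = {\<omega> \<in> space M. ecard {i. \<omega> \<in> fresh_conn i} = enat n}"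
    by (auto simp: origin_degree_eq)
  then show ?thesis
    by (simp add: ecard_event)
qed

lemma origin_degree_cdf_event: "{\<omega> \<in> space M. origin_degree X Y E \<omega> \<le> enat m} \<in> events"
proof -
  have "{\<omega> \<in> space M. origin_degree X Y E \<omega> \<le> enat m}
      = (\<Union>n\<in>{..m}. {\<omega> \<in> space M. origin_degree X Y E \<omega> = enat n})"
    by (auto simp: origin_degree_def ecard_le_iff)
  also have "\<dots> \<in> events"
    by (intro sets.finite_UN origin_degree_event) auto
  finally show ?thesis .
qed

lemma origin_degree_measurable: "origin_degree X Y E \<in> measurable M (count_space UNIV)"
proof (rule measurable_count_space_eq_countable[THEN iffD2])
  show "countable (UNIV :: enat set)"
    by simp
  show "origin_degree X Y E \<in> space M \<rightarrow> UNIV \<and> (\<forall>a\<in>UNIV. origin_degree X Y E -` {a} \<inter> space M \<in> events)"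
  proof (intro conjI ballI)
    fix a :: enat
    show "origin_degree X Y E -` {a} \<inter> space M \<in> events"
    proof (cases a)
      case (enat n)
      have "origin_degree X Y E -` {a} \<inter> space M = {\<omega> \<in> space M. origin_degree X Y E \<omega> = enat n}"
        using enat by auto
      then show ?thesis
        by (simp add: origin_degree_event)
    next
      case infinity
      have "origin_degree X Y E -` {a} \<inter> space M
          = space M - (\<Union>n. {\<omega> \<in> space M. origin_degree X Y E \<omega> = enat n})"
        using infinity by (auto simp: not_infinity_eq[symmetric] simp del: not_infinity_eq)
      also have "\<dots> \<in> events"
        using origin_degree_event by auto
      finally show ?thesis .
    qed
  qed simp
qed

lemma origin_degree_cdf_ge:
  "(\<Sum>n<n0. pois (mu * mass) n * pois_cdf (real n * (lam * mass)) m)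
    \<le> prob {\<omega> \<in> space M. origin_degree X Y E \<omega> \<le> enat m}"
proof -
  have "prob {\<omega> \<in> space M. ecard {i. \<omega> \<in> conn_any i} \<le> enat m}
      \<le> prob {\<omega> \<in> space M. origin_degree X Y E \<omega> \<le> enat m}"
  proof (rule finite_measure_mono)
    show "{\<omega> \<in> space M. ecard {i. \<omega> \<in> conn_any i} \<le> enat m}
      \<subseteq> {\<omega> \<in> space M. origin_degree X Y E \<omega> \<le> enat m}"
    proof safe
      fix \<omega> assume "\<omega> \<in> space M" and le: "ecard {i. \<omega> \<in> conn_any i} \<le> enat m"
      have "ecard {i. \<omega> \<in> fresh_conn i} \<le> ecard {i. \<omega> \<in> conn_any i}"
        by (rule ecard_le_mono) (auto simp: fresh_conn_def)
      with le show "origin_degree X Y E \<omega> \<le> enat m"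
        using \<open>\<omega> \<in> space M\<close> by (simp add: origin_degree_eq)
    qed
  qed (rule origin_degree_cdf_event)
  with count_conn_any_cdf_ge show ?thesis
    by (rule order_trans)
qed

end

section \<open>The compound Poisson variable\<close>

text \<open>Conditioning on \<open>N = n\<close> leaves a sum of \<open>n\<close> independent Poisson variables of mean \<open>b\<close>, which
  is Poisson distributed with mean \<open>n * b\<close> by comparison of generating functions.\<close>

lemma (in prob_space) compound_poisson_cdf:
  fixes N :: "'a \<Rightarrow> nat" and Z :: "nat \<Rightarrow> 'a \<Rightarrow> nat"
  assumes a: "a > 0" and b: "b > 0"
    and Z [measurable]: "\<And>i. i \<ge> 1 \<Longrightarrow> Z i \<in> measurable M (count_space UNIV)"
    and Z_distr: "\<And>i. i \<ge> 1 \<Longrightarrow> distr M (count_space UNIV) (Z i) = measure_pmf (poisson_pmf b)"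
    and Z_indep: "indep_vars (\<lambda>_. count_space UNIV) Z {1..}"
    and N [measurable]: "N \<in> measurable M (count_space UNIV)"
    and N_distr: "distr M (count_space UNIV) N = measure_pmf (poisson_pmf a)"
    and NZ: "indep_set
           (sets (vimage_algebra (space M) N (count_space UNIV)))
           (sets (vimage_algebra (space M) (\<lambda>\<omega>. \<lambda>i\<in>{1..}. Z i \<omega>) (\<Pi>\<^sub>M i\<in>{1..}. count_space UNIV)))"
  shows "(\<lambda>n. pois a n * pois_cdf (real n * b) m) sums prob {\<omega> \<in> space M. (\<Sum>i=1..N \<omega>. Z i \<omega>) \<le> m}"
proof -
  define S where "S n \<omega> = (\<Sum>i=1..n. Z i \<omega>)" for n \<omega>
  have S_meas [measurable]: "S n \<in> measurable M (count_space UNIV)" for n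
  proof (induction n)
    case (Suc n)
    have "S (Suc n) = (\<lambda>\<omega>. S n \<omega> + Z (Suc n) \<omega>)"
      by (auto simp: S_def)
    then show ?case
      using Suc Z[of "Suc n"] by simp
  qed (simp add: S_def)
  have pmf: "pmf (poisson_pmf c) n = pois c n" if "c > 0" for c n
    using that by (simp add: pois_def)
  have S_law: "prob {\<omega> \<in> space M. S n \<omega> = k} = pois (real n * b) k" for n k
  proof (rule pgf_coeffs_unique)
    fix s :: real assume s: "0 \<le> s" "s < 1"
    show "(\<lambda>k. pois (real n * b) k * s ^ k) sums exp (- ((1 - s) * (real n * b)))"
      by (rule pois_pgf)
    have "expectation (\<lambda>\<omega>. s ^ S n \<omega>) = expectation (\<lambda>\<omega>. \<Prod>i\<in>{1..n}. s ^ Z i \<omega>)"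
      by (simp add: S_def power_sum)
    also have "\<dots> = (\<Prod>i\<in>{1..n}. expectation (\<lambda>\<omega>. s ^ Z i \<omega>))"
    proof (rule indep_vars_lebesgue_integral)
      show "indep_vars (\<lambda>_. borel) (\<lambda>i \<omega>. s ^ Z i \<omega>) {1..n}"
        by (rule indep_vars_compose2[OF indep_vars_subset[OF Z_indep]]) auto
      show "integrable M (\<lambda>\<omega>. s ^ Z i \<omega>)" if "i \<in> {1..n}" for i
        using measurable_compose[OF Z, of i "\<lambda>k. s ^ k" borel] that s
        by (intro integrable_const_bound[where B=1]) (auto simp: power_le_one)
    qed simp
    also have "\<dots> = (\<Prod>i\<in>{1..n}. exp (- ((1 - s) * b)))"
      using s b by (intro prod.cong refl expectation_power_poisson[OF Z Z_distr]) (auto simp: pois_def)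
    also have "\<dots> = exp (- ((1 - s) * (real n * b)))"
      by (simp add: exp_of_nat_mult[symmetric] mult_ac)
    finally have "expectation (\<lambda>\<omega>. s ^ S n \<omega>) = exp (- ((1 - s) * (real n * b)))" .
    moreover have "{\<omega> \<in> space M. enat (S n \<omega>) = enat k} \<in> events" for k
      by simp
    from pgf_sums[OF this, of s] have "(\<lambda>k. prob {\<omega> \<in> space M. S n \<omega> = k} * s ^ k) sums expectation (\<lambda>\<omega>. s ^ S n \<omega>)"
      using s by (simp add: epow_def)
    ultimately show "(\<lambda>k. prob {\<omega> \<in> space M. S n \<omega> = k} * s ^ k) sums exp (- ((1 - s) * (real n * b)))"
      by simp
  qed
  have S_cdf: "prob {\<omega> \<in> space M. S n \<omega> \<le> m} = pois_cdf (real n * b) m" for n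
  proof -
    have "{\<omega> \<in> space M. S n \<omega> \<le> m} = (\<Union>k\<in>{..m}. {\<omega> \<in> space M. S n \<omega> = k})"
      by auto
    also have "prob \<dots> = (\<Sum>k\<le>m. prob {\<omega> \<in> space M. S n \<omega> = k})"
      by (rule finite_measure_finite_Union) (auto simp: disjoint_family_on_def)
    finally show ?thesis
      by (simp add: S_law pois_cdf_def)
  qed
  have N_law: "prob {\<omega> \<in> space M. N \<omega> = n} = pois a n" for n
    unfolding prob_eq_pmf[OF N N_distr] using a by (rule pmf)
  have joint: "prob ({\<omega> \<in> space M. N \<omega> = n} \<inter> {\<omega> \<in> space M. S n \<omega> \<le> m})
      = prob {\<omega> \<in> space M. N \<omega> = n} * prob {\<omega> \<in> space M. S n \<omega> \<le> m}" for n
  proof (rule indep_setD[OF NZ])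
    show "{\<omega> \<in> space M. N \<omega> = n} \<in> sets (vimage_algebra (space M) N (count_space UNIV))"
      by (subst sets_vimage_algebra2) (auto intro!: exI[of _ "{n}"])
    let ?P = "\<Pi>\<^sub>M i\<in>{1::nat..}. count_space (UNIV :: nat set)"
    have "(\<lambda>z. \<Sum>i=1..n. z i) \<in> measurable ?P (count_space UNIV)" for n
    proof (induction n)
      case (Suc n)
      have "(\<lambda>z. z (Suc n)) \<in> measurable ?P (count_space UNIV)"
        by (rule measurable_component_singleton) simp
      with Suc show ?case
        by simp
    qed simp
    then have "{z \<in> space ?P. (\<Sum>i=1..n. z i) \<le> m} \<in> sets ?P"
      by measurable
    moreover have "{\<omega> \<in> space M. S n \<omega> \<le> m}
        = (\<lambda>\<omega>. \<lambda>i\<in>{1..}. Z i \<omega>) -` {z \<in> space ?P. (\<Sum>i=1..n. z i) \<le> m} \<inter> space M"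
      by (auto simp: S_def space_PiM PiE_def)
    ultimately show "{\<omega> \<in> space M. S n \<omega> \<le> m} \<in> sets (vimage_algebra (space M) (\<lambda>\<omega>. \<lambda>i\<in>{1..}. Z i \<omega>) ?P)"
      by (simp only: in_vimage_algebra)
  qed
  have "(\<lambda>n. prob ({\<omega> \<in> space M. N \<omega> = n} \<inter> {\<omega> \<in> space M. S n \<omega> \<le> m}))
      sums prob (\<Union>n. {\<omega> \<in> space M. N \<omega> = n} \<inter> {\<omega> \<in> space M. S n \<omega> \<le> m})"
    by (rule finite_measure_UNION) (auto simp: disjoint_family_on_def)
  moreover have "(\<Union>n. {\<omega> \<in> space M. N \<omega> = n} \<inter> {\<omega> \<in> space M. S n \<omega> \<le> m})
      = {\<omega> \<in> space M. (\<Sum>i=1..N \<omega>. Z i \<omega>) \<le> m}"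
    by (auto simp: S_def)
  ultimately show ?thesis
    by (simp add: joint S_cdf N_law)
qed

section \<open>Stochastic domination\<close>

theorem proposition2:
  fixes lam mu :: real
    and g :: "'a::euclidean_space \<Rightarrow> real"
    and M :: "'w measure"
    and X Y :: "nat \<Rightarrow> 'w \<Rightarrow> 'a"
    and E :: "'w \<Rightarrow> ('a \<times> 'a) set"
    and M' :: "'v measure"
    and N :: "'v \<Rightarrow> nat"
    and Z :: "nat \<Rightarrow> 'v \<Rightarrow> nat"
  assumes "lam > 0" and "mu > 0"
    and "\<And>x. g x \<in> {0..1}"
    and "nonincreasing_radial g"
    and "integrable lborel g"
    and "(LINT x|lborel. g x) > 0"
    and "random_bipartite_graph M lam mu g X Y E"
    and "prob_space M'"
    and "\<And>i. i \<ge> 1 \<Longrightarrow> Z i \<in> measurable M' (count_space UNIV)"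
    and "\<And>i. i \<ge> 1 \<Longrightarrow>
           distr M' (count_space UNIV) (Z i) = measure_pmf (poisson_pmf (lam * (LINT x|lborel. g x)))"
    and "prob_space.indep_vars M' (\<lambda>_. count_space UNIV) Z {1..}"
    and "N \<in> measurable M' (count_space UNIV)"
    and "distr M' (count_space UNIV) N = measure_pmf (poisson_pmf (mu * (LINT x|lborel. g x)))"
    and "prob_space.indep_set M'
           (sets (vimage_algebra (space M') N (count_space UNIV)))
           (sets (vimage_algebra (space M') (\<lambda>\<omega>. \<lambda>i\<in>{1..}. Z i \<omega>) (\<Pi>\<^sub>M i\<in>{1..}. count_space UNIV)))"
  shows "stoch_dominated
           M (\<lambda>\<omega>. ereal_of_enat (origin_degree X Y E \<omega>))
           M' (\<lambda>\<omega>. ereal (real (\<Sum>i=1..N \<omega>. Z i \<omega>)))"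
proof -
  interpret random_bipartite_graph M lam mu g X Y E by fact
  interpret intersection_graph M lam mu g X Y E
  proof
    have "norm (- x) = norm x \<longrightarrow> g (- x) = g x" for x
      using assms(4) unfolding nonincreasing_radial_def by blast
    then show "g (- x) = g x" for x
      by simp
  qed (fact assms)+
  interpret M': prob_space M' by fact
  let ?D = "origin_degree X Y E"
  define S where "S \<omega> = (\<Sum>i=1..N \<omega>. Z i \<omega>)" for \<omega>
  have S_meas [measurable]: "S \<in> measurable M' (count_space UNIV)"
  proof -
    have "(\<lambda>\<omega>. \<Sum>i=1..n. Z i \<omega>) \<in> measurable M' (count_space UNIV)" for n
    proof (induction n)
      case (Suc n)
      then show ?case
        using assms(9)[of "Suc n"] by simp
    qed simp
    from measurable_compose_countable[OF this assms(12)] show ?thesis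
      by (simp add: S_def[abs_def])
  qed
  have S_le_meas: "{\<omega> \<in> space M'. S \<omega> \<le> m} \<in> sets M'" for m
    by measurable
  \<comment> \<open>The distribution function of the compound Poisson variable is the limit of the finite sums by
    which that of the degree is bounded below.\<close>
  have cdf: "M'.prob {\<omega> \<in> space M'. S \<omega> \<le> m} \<le> prob {\<omega> \<in> space M. ?D \<omega> \<le> enat m}" for m
  proof (rule LIMSEQ_le_const2)
    show "(\<lambda>k. \<Sum>n<k. pois (mu * mass) n * pois_cdf (real n * (lam * mass)) m)
        \<longlonglongrightarrow> M'.prob {\<omega> \<in> space M'. S \<omega> \<le> m}"
      using M'.compound_poisson_cdf[of "mu * mass" "lam * mass" Z N m] assms(1,2,6,9-14)
      by (simp add: S_def sums_def)
  qed (use origin_degree_cdf_ge in blast)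
  show ?thesis
    unfolding stoch_dominated_def
  proof (intro conjI allI)
    show "(\<lambda>\<omega>. ereal_of_enat (?D \<omega>)) \<in> borel_measurable M"
      by (rule measurable_compose[OF origin_degree_measurable]) simp
    show "(\<lambda>\<omega>. ereal (real (\<Sum>i=1..N \<omega>. Z i \<omega>))) \<in> borel_measurable M'"
      unfolding S_def[symmetric] by (rule measurable_compose[OF S_meas]) simp
    fix t :: real
    show "prob {\<omega> \<in> space M. ereal_of_enat (?D \<omega>) > ereal t}
        \<le> M'.prob {\<omega> \<in> space M'. ereal (real (\<Sum>i=1..N \<omega>. Z i \<omega>)) > ereal t}"
      unfolding S_def[symmetric]
    proof (cases "t < 0")
      case True
      then have "{\<omega> \<in> space M'. ereal (real (S \<omega>)) > ereal t} = space M'"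
        by auto
      then show "prob {\<omega> \<in> space M. ereal_of_enat (?D \<omega>) > ereal t}
        \<le> M'.prob {\<omega> \<in> space M'. ereal (real (S \<omega>)) > ereal t}"
        by (simp add: M'.prob_space)
    next
      case False
      \<comment> \<open>Both variables take values in the natural numbers or \<open>\<infinity>\<close>, so only integer thresholds matter.\<close>
      define m where "m = nat \<lfloor>t\<rfloor>"
      have nat_gt: "real k > t \<longleftrightarrow> \<not> k \<le> m" for k :: nat
        using False unfolding m_def by linarith
      have "{\<omega> \<in> space M. ereal_of_enat (?D \<omega>) > ereal t} = space M - {\<omega> \<in> space M. ?D \<omega> \<le> enat m}"
      proof -
        have "ereal_of_enat k > ereal t \<longleftrightarrow> \<not> k \<le> enat m" for k
          by (cases k) (simp_all add: nat_gt)
        then show ?thesis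
          by auto
      qed
      moreover have "{\<omega> \<in> space M'. ereal (real (S \<omega>)) > ereal t} = space M' - {\<omega> \<in> space M'. S \<omega> \<le> m}"
        using nat_gt by auto
      ultimately show "prob {\<omega> \<in> space M. ereal_of_enat (?D \<omega>) > ereal t}
        \<le> M'.prob {\<omega> \<in> space M'. ereal (real (S \<omega>)) > ereal t}"
        using cdf[of m] by (simp add: prob_compl M'.prob_compl origin_degree_cdf_event S_le_meas)
    qed
  qed
qed

end
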